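(* Let $(A,H,D)$ be the Hodge-de Rham spectral triple of the flat $2$-torus $\mathbb{T}^2=\mathbb{R}^2/\mathbb{Z}^2$ in its matrix form: $A=C^\infty(\mathbb{T}^2)$ acts by pointwise multiplication on $H=M_2(L^2(\mathbb{T}^2))$ and $D=iL_{\sigma_1}\frac{\partial}{\partial x}+iL_{\sigma_2}\frac{\partial}{\partial y}$. There is no (bijective) antilinear isometry $J$ on $H$ satisfying both of the following conditions: (a) $J$ preserves the domain of $D$ and $JD=\varepsilon' DJ$ for some sign $\varepsilon'\in\{+1,-1\}$; (b) (second-order condition) $\mathcal{C}\ell_D(A)^\circ\subset\mathcal{C}\ell_D(A)'$.
   Context: $H=M_2(L^2(\mathbb{T}^2))$ has inner product $\langle a,b\rangle=\frac12\int_0^1dx\int_0^1dy\,\mathrm{Tr}(a^*b)$. $L_a b=ab$ and $R_ab=ba$ denote pointwise left and right matrix multiplication, and $\sigma_1=\begin{pmatrix}0&1\\1&0\end{pmatrix}$, $\sigma_2=\begin{pmatrix}0&-i\\i&0\end{pmatrix}$ are Pauli matrices. $D$ is understood as a self-adjoint operator (the closure of the given differential operator on $M_2(C^\infty(\mathbb{T}^2))$); a scalar function $f\in A$ acts on $H$ by entrywise multiplication. $\Omega^1_D(A)$ is the complex linear span in $\mathcal{B}(H)$ of the operators $a[D,b]$, $a,b\in A$ (where $[D,b]$ denotes the bounded extension), and $\mathcal{C}\ell_D(A)$ is the complex $C^*$-subalgebra of $\mathcal{B}(H)$ generated by $A$ and $\Omega^1_D(A)$. For $S\subset\mathcal{B}(H)$,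 $S'$ is the commutant of $S$ in $\mathcal{B}(H)$, and, given $J$, $\xi^\circ=J\xi^*J^{-1}$ for $\xi\in\mathcal{B}(H)$ and $S^\circ=\{\xi^\circ:\xi\in S\}$. *)

theory Defs
  imports "HOL-Analysis.Analysis"
begin

type_synonym cmat2 = "complex^2^2"

definition sigma1 :: cmat2 where
  "sigma1 = vector [vector [0, 1], vector [1, 0]]"

definition sigma2 :: cmat2 where
  "sigma2 = vector [vector [0, - \<i>], vector [\<i>, 0]]"

definition ctranspose :: "cmat2 \<Rightarrow> cmat2" where
  "ctranspose A = (\<chi> i j. cnj (A $ j $ i))"

definition smult_mat :: "complex \<Rightarrow> cmat2 \<Rightarrow> cmat2"  (infixr \<open>*\<^sub>M\<close> 75) where
  "c *\<^sub>M A = (\<chi> i j. c * A $ i $ j)"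

lemma trace_ctranspose: "trace (ctranspose A ** B) = (\<Sum>i\<in>UNIV. \<Sum>j\<in>UNIV. cnj (A $ j $ i) * B $ j $ i)"
  by (simp add: trace_def ctranspose_def matrix_matrix_mult_def)

lemma norm_cmat2_sq: "(norm (A :: cmat2))\<^sup>2 = (\<Sum>i\<in>UNIV. \<Sum>j\<in>UNIV. (cmod (A $ j $ i))\<^sup>2)"
  by (simp add: norm_vec_def L2_set_def sum_nonneg) (rule sum.swap)

lemma trace_ctranspose_self: "trace (ctranspose A ** A) = of_real ((norm A)\<^sup>2)"
  unfolding trace_ctranspose norm_cmat2_sq
  by (simp add: complex_norm_square mult.commute flip: of_real_power)

lemma cmod_trace_ctranspose_le:
  "cmod (trace (ctranspose A ** B)) \<le> (norm A)\<^sup>2 + (norm B)\<^sup>2"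
proof -
  have "cmod (trace (ctranspose A ** B)) \<le> (\<Sum>i\<in>UNIV. \<Sum>j\<in>UNIV. cmod (A $ j $ i) * cmod (B $ j $ i))"
    unfolding trace_ctranspose
    by (intro order_trans[OF norm_sum] sum_mono order_trans[OF norm_sum]) (simp add: norm_mult)
  also have "\<dots> \<le> (\<Sum>i\<in>UNIV. \<Sum>j\<in>UNIV. (cmod (A $ j $ i))\<^sup>2 + (cmod (B $ j $ i))\<^sup>2)"
  proof (intro sum_mono)
    fix i j
    have "2 * (cmod (A $ j $ i) * cmod (B $ j $ i)) \<le> (cmod (A $ j $ i))\<^sup>2 + (cmod (B $ j $ i))\<^sup>2"
      using sum_squares_bound[of "cmod (A $ j $ i)" "cmod (B $ j $ i)"] by (simp add: mult.assoc)
    moreover have "0 \<le> cmod (A $ j $ i) * cmod (B $ j $ i)" by simp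
    ultimately show "cmod (A $ j $ i) * cmod (B $ j $ i) \<le> (cmod (A $ j $ i))\<^sup>2 + (cmod (B $ j $ i))\<^sup>2"
      by linarith
  qed
  also have "\<dots> = (norm A)\<^sup>2 + (norm B)\<^sup>2"
    unfolding norm_cmat2_sq by (simp add: sum.distrib)
  finally show ?thesis .
qed

lemma norm_smult_mat: "norm (c *\<^sub>M A) = cmod c * norm A"
proof -
  have "(norm (c *\<^sub>M A))\<^sup>2 = (cmod c * norm A)\<^sup>2"
    unfolding power_mult_distrib norm_cmat2_sq
    by (simp add: smult_mat_def norm_mult power_mult_distrib sum_distrib_left)
  then show ?thesis by (simp add: power2_eq_iff_nonneg)
qed

lemma trace_ctranspose_add_left:
  "trace (ctranspose (A + B) ** C) = trace (ctranspose A ** C) + trace (ctranspose B ** C)"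
  by (simp add: trace_ctranspose algebra_simps sum.distrib)

lemma trace_ctranspose_scaleR_left:
  "trace (ctranspose (r *\<^sub>R A) ** C) = of_real r * trace (ctranspose A ** C)"
  unfolding trace_ctranspose sum_distrib_left by (simp add: scaleR_conv_of_real[where 'a=complex] mult.assoc)

lemma trace_ctranspose_commute:
  "trace (ctranspose A ** B) = cnj (trace (ctranspose B ** A))"
  by (simp add: trace_ctranspose mult.commute)

lemma continuous_on_smult_mat [continuous_intros]:
  "continuous_on S f \<Longrightarrow> continuous_on S g \<Longrightarrow> continuous_on S (\<lambda>x. f x *\<^sub>M g x)"
  unfolding smult_mat_def
  by (intro continuous_intros continuous_on_vec_lambda)

lemma continuous_on_trace_ctranspose [continuous_intros]:
  "continuous_on S f \<Longrightarrow> continuous_on S g \<Longrightarrow> continuous_on S (\<lambda>x. trace (ctranspose (f x) ** g x))"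
  unfolding trace_ctranspose by (intro continuous_intros)

text \<open>Functions on the torus are functions on the plane that are invariant under
  integer translations in both variables; the torus is measured on a fundamental square.\<close>

definition periodic :: "(real \<times> real \<Rightarrow> 'b) \<Rightarrow> bool" where
  "periodic f \<longleftrightarrow> (\<forall>x y. f (x + 1, y) = f (x, y) \<and> f (x, y + 1) = f (x, y))"

definition torus :: "(real \<times> real) measure" where
  "torus = restrict_space lborel ({0..1} \<times> {0..1})"

definition L2_fun :: "(real \<times> real \<Rightarrow> cmat2) \<Rightarrow> bool" where
  "L2_fun F \<longleftrightarrow> F \<in> borel_measurable borel \<and> periodic F \<and>
     integrable torus (\<lambda>p. (norm (F p))\<^sup>2)"

definition L2_rel :: "(real \<times> real \<Rightarrow> cmat2) \<Rightarrow> (real \<times> real \<Rightarrow> cmat2) \<Rightarrow> bool" where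
  "L2_rel F G \<longleftrightarrow> L2_fun F \<and> L2_fun G \<and> (AE p in torus. F p = G p)"

lemma measurable_torus: "f \<in> borel_measurable borel \<Longrightarrow> f \<in> borel_measurable torus"
  unfolding torus_def by (rule measurable_restrict_space1) simp

lemma L2_fun_zero: "L2_fun (\<lambda>p. 0)"
  by (simp add: L2_fun_def periodic_def)

quotient_type l2mat = "real \<times> real \<Rightarrow> cmat2" / partial: L2_rel
proof (rule part_equivpI)
  show "\<exists>F. L2_rel F F" using L2_fun_zero by (auto simp: L2_rel_def)
  show "symp L2_rel" by (auto simp: symp_def L2_rel_def)
  show "transp L2_rel"
    unfolding transp_def L2_rel_def by (auto elim: AE_mp)
qed

lemma L2_fun_add:
  assumes "L2_fun F" "L2_fun G"
  shows "L2_fun (\<lambda>p. F p + G p)"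
proof -
  have m: "F \<in> borel_measurable borel" "G \<in> borel_measurable borel"
    using assms by (auto simp: L2_fun_def)
  have "integrable torus (\<lambda>p. (norm (F p + G p))\<^sup>2)"
  proof (rule Bochner_Integration.integrable_bound)
    show "integrable torus (\<lambda>p. 2 * (norm (F p))\<^sup>2 + 2 * (norm (G p))\<^sup>2)"
      using assms by (auto simp: L2_fun_def)
    show "(\<lambda>p. (norm (F p + G p))\<^sup>2) \<in> borel_measurable torus"
      by (rule measurable_torus) (use m in measurable)
    have "(norm (a + b))\<^sup>2 \<le> 2 * (norm a)\<^sup>2 + 2 * (norm b)\<^sup>2" for a b :: cmat2
    proof -
      have "(norm (a + b))\<^sup>2 \<le> (norm a + norm b)\<^sup>2"
        by (intro power_mono norm_triangle_ineq) simp
      also have "\<dots> \<le> 2 * (norm a)\<^sup>2 + 2 * (norm b)\<^sup>2"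
        using sum_squares_bound[of "norm a" "norm b"] by (simp add: power2_sum)
      finally show ?thesis .
    qed
    then show "AE p in torus. norm ((norm (F p + G p))\<^sup>2) \<le> norm (2 * (norm (F p))\<^sup>2 + 2 * (norm (G p))\<^sup>2)"
      by simp
  qed
  then show ?thesis using assms m by (auto simp: L2_fun_def periodic_def)
qed

lemma L2_fun_smult:
  assumes "L2_fun F"
  shows "L2_fun (\<lambda>p. c *\<^sub>M F p)"
proof -
  have m: "F \<in> borel_measurable borel" using assms by (auto simp: L2_fun_def)
  have "continuous_on UNIV (\<lambda>A. c *\<^sub>M A)" by (intro continuous_intros)
  then have "(\<lambda>p. c *\<^sub>M F p) \<in> borel_measurable borel"
    using m borel_measurable_continuous_on by blast
  then show ?thesis
    using assms by (auto simp: L2_fun_def periodic_def norm_smult_mat power_mult_distrib)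
qed

lemma L2_fun_scaleR: "L2_fun F \<Longrightarrow> L2_fun (\<lambda>p. r *\<^sub>R F p)"
  by (auto simp: L2_fun_def periodic_def power_mult_distrib)

lemma L2_fun_uminus: "L2_fun F \<Longrightarrow> L2_fun (\<lambda>p. - F p)"
  using L2_fun_scaleR[of F "-1"] by simp

lemma L2_fun_minus: "L2_fun F \<Longrightarrow> L2_fun G \<Longrightarrow> L2_fun (\<lambda>p. F p - G p)"
  using L2_fun_add[of F "\<lambda>p. - G p"] L2_fun_uminus[of G] by simp

lemma measurable_trace_ctranspose:
  assumes "F \<in> borel_measurable M" "G \<in> borel_measurable M"
  shows "(\<lambda>p. trace (ctranspose (F p) ** G p)) \<in> borel_measurable M"
  by (rule borel_measurable_continuous_Pair[OF assms])
     (intro continuous_intros)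

lemma integrable_trace_ctranspose:
  assumes "L2_fun F" "L2_fun G"
  shows "integrable torus (\<lambda>p. trace (ctranspose (F p) ** G p))"
proof (rule Bochner_Integration.integrable_bound)
  show "integrable torus (\<lambda>p. (norm (F p))\<^sup>2 + (norm (G p))\<^sup>2)"
    using assms by (auto simp: L2_fun_def)
  show "(\<lambda>p. trace (ctranspose (F p) ** G p)) \<in> borel_measurable torus"
    using assms by (intro measurable_trace_ctranspose measurable_torus) (auto simp: L2_fun_def)
  show "AE p in torus. norm (trace (ctranspose (F p) ** G p)) \<le> norm ((norm (F p))\<^sup>2 + (norm (G p))\<^sup>2)"
    by (intro AE_I2) (use cmod_trace_ctranspose_le in force)
qed

lift_definition cinner :: "l2mat \<Rightarrow> l2mat \<Rightarrow> complex" is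
  "\<lambda>F G. 1/2 * (LINT p|torus. trace (ctranspose (F p) ** G p))"
proof -
  fix F F' G G' assume a: "L2_rel F F'" "L2_rel G G'"
  have "(LINT p|torus. trace (ctranspose (F p) ** G p)) = (LINT p|torus. trace (ctranspose (F' p) ** G' p))"
  proof (rule integral_cong_AE)
    show "AE p in torus. trace (ctranspose (F p) ** G p) = trace (ctranspose (F' p) ** G' p)"
      using a unfolding L2_rel_def by (auto elim: AE_mp)
  qed (use a in \<open>auto simp: L2_rel_def L2_fun_def intro!: measurable_trace_ctranspose measurable_torus\<close>)
  then show "1/2 * (LINT p|torus. trace (ctranspose (F p) ** G p)) = 1/2 * (LINT p|torus. trace (ctranspose (F' p) ** G' p))"
    by simp
qed

lift_definition scaleC :: "complex \<Rightarrow> l2mat \<Rightarrow> l2mat"  (infixr \<open>*\<^sub>C\<close> 75) is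
  "\<lambda>c F p. c *\<^sub>M F p"
  by (auto simp: L2_rel_def L2_fun_smult)

instantiation l2mat :: real_inner
begin

lift_definition zero_l2mat :: l2mat is "\<lambda>p. 0"
  by (simp add: L2_rel_def L2_fun_zero)

lift_definition plus_l2mat :: "l2mat \<Rightarrow> l2mat \<Rightarrow> l2mat" is "\<lambda>F G p. F p + G p"
  unfolding L2_rel_def by (auto simp: L2_fun_add elim: AE_mp)

lift_definition minus_l2mat :: "l2mat \<Rightarrow> l2mat \<Rightarrow> l2mat" is "\<lambda>F G p. F p - G p"
  unfolding L2_rel_def by (auto simp: L2_fun_minus elim: AE_mp)

lift_definition uminus_l2mat :: "l2mat \<Rightarrow> l2mat" is "\<lambda>F p. - F p"
  by (auto simp: L2_rel_def L2_fun_uminus)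

lift_definition scaleR_l2mat :: "real \<Rightarrow> l2mat \<Rightarrow> l2mat" is "\<lambda>r F p. r *\<^sub>R F p"
  by (auto simp: L2_rel_def L2_fun_scaleR)

definition inner_l2mat :: "l2mat \<Rightarrow> l2mat \<Rightarrow> real" where
  "inner_l2mat v w = Re (cinner v w)"

definition norm_l2mat :: "l2mat \<Rightarrow> real" where
  "norm_l2mat v = sqrt (inner v v)"

definition dist_l2mat :: "l2mat \<Rightarrow> l2mat \<Rightarrow> real" where
  "dist_l2mat v w = norm (v - w)"

definition sgn_l2mat :: "l2mat \<Rightarrow> l2mat" where
  "sgn_l2mat v = inverse (norm v) *\<^sub>R v"

definition uniformity_l2mat :: "(l2mat \<times> l2mat) filter" where
  "uniformity_l2mat = (INF e\<in>{0 <..}. principal {(v, w). dist v w < e})"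

definition open_l2mat :: "l2mat set \<Rightarrow> bool" where
  "open_l2mat U = (\<forall>v\<in>U. \<forall>\<^sub>F (v', w) in uniformity. v' = v \<longrightarrow> w \<in> U)"

instance
proof
  fix u v w :: l2mat and r s :: real
  show "u + v + w = u + (v + w)"
    by transfer (auto simp: L2_rel_def L2_fun_add add.assoc)
  show "u + v = v + u"
    by transfer (auto simp: L2_rel_def L2_fun_add add.commute)
  show "0 + u = u"
    by transfer (auto simp: L2_rel_def)
  show "- u + u = 0"
    by transfer (auto simp: L2_rel_def L2_fun_zero)
  show "u - v = u + - v"
    by transfer (auto simp: L2_rel_def L2_fun_minus)
  show "r *\<^sub>R (u + v) = r *\<^sub>R u + r *\<^sub>R v"
    by transfer (auto simp: L2_rel_def L2_fun_add L2_fun_scaleR scaleR_add_right)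
  show "(r + s) *\<^sub>R u = r *\<^sub>R u + s *\<^sub>R u"
    by transfer (auto simp: L2_rel_def L2_fun_add L2_fun_scaleR scaleR_add_left)
  show "r *\<^sub>R s *\<^sub>R u = (r * s) *\<^sub>R u"
    by transfer (auto simp: L2_rel_def L2_fun_scaleR)
  show "1 *\<^sub>R u = u"
    by transfer (auto simp: L2_rel_def)
  show "dist u v = norm (u - v)" by (rule dist_l2mat_def)
  show "sgn u = inverse (norm u) *\<^sub>R u" by (rule sgn_l2mat_def)
  show "uniformity = (INF e\<in>{0 <..}. principal {(v, w :: l2mat). dist v w < e})"
    by (rule uniformity_l2mat_def)
  show "open U = (\<forall>v\<in>U. \<forall>\<^sub>F (v', w) in uniformity. v' = v \<longrightarrow> w \<in> U)" for U :: "l2mat set"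
    by (rule open_l2mat_def)
  have "cinner u v = cnj (cinner v u)"
  proof transfer
    fix F G :: "real \<times> real \<Rightarrow> cmat2"
    have "(LINT p|torus. trace (ctranspose (F p) ** G p)) = (LINT p|torus. cnj (trace (ctranspose (G p) ** F p)))"
      by (intro Bochner_Integration.integral_cong refl trace_ctranspose_commute)
    then show "1/2 * (LINT p|torus. trace (ctranspose (F p) ** G p)) =
        cnj (1/2 * (LINT p|torus. trace (ctranspose (G p) ** F p)))"
      by (simp only: integral_cnj) simp
  qed
  then show "inner u v = inner v u" by (simp add: inner_l2mat_def)
  have "cinner (u + v) w = cinner u w + cinner v w"
    by transfer (simp add: L2_rel_def trace_ctranspose_add_left integrable_trace_ctranspose distrib_left)
  then show "inner (u + v) w = inner u w + inner v w" by (simp add: inner_l2mat_def)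
  have "cinner (r *\<^sub>R u) v = of_real r * cinner u v"
    by transfer (simp only: trace_ctranspose_scaleR_left integral_mult_right_zero mult.left_commute)
  then show "inner (r *\<^sub>R u) v = r * inner u v" by (simp add: inner_l2mat_def)
  have self: "\<exists>F. L2_fun F \<and> inner u u = 1/2 * (LINT p|torus. (norm (F p))\<^sup>2) \<and>
      (u = 0 \<longleftrightarrow> (AE p in torus. F p = 0))"
    unfolding inner_l2mat_def
    by transfer (auto simp: L2_rel_def L2_fun_zero trace_ctranspose_self integral_complex_of_real
        simp del: of_real_power)
  then obtain F where F: "L2_fun F" "inner u u = 1/2 * (LINT p|torus. (norm (F p))\<^sup>2)"
      "u = 0 \<longleftrightarrow> (AE p in torus. F p = 0)" by blast
  show "0 \<le> inner u u" unfolding F(2) by simp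
  show "inner u u = 0 \<longleftrightarrow> u = 0"
    unfolding F(2,3) using F(1) integral_nonneg_eq_0_iff_AE[of torus "\<lambda>p. (norm (F p))\<^sup>2"]
    by (simp add: L2_fun_def)
  show "norm u = sqrt (inner u u)" by (rule norm_l2mat_def)
qed

end

definition pdx :: "(real \<times> real \<Rightarrow> 'b::real_normed_vector) \<Rightarrow> real \<times> real \<Rightarrow> 'b" where
  "pdx f p = vector_derivative (\<lambda>t. f (t, snd p)) (at (fst p))"

definition pdy :: "(real \<times> real \<Rightarrow> 'b::real_normed_vector) \<Rightarrow> real \<times> real \<Rightarrow> 'b" where
  "pdy f p = vector_derivative (\<lambda>t. f (fst p, t)) (at (snd p))"

text \<open>\<open>C\<^sup>k\<close> in terms of iterated partial derivatives: all of them up to order \<open>k\<close> exist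
  and are continuous on the whole plane.\<close>

primrec Ck :: "nat \<Rightarrow> (real \<times> real \<Rightarrow> 'b::real_normed_vector) \<Rightarrow> bool" where
  "Ck 0 f \<longleftrightarrow> continuous_on UNIV f"
| "Ck (Suc k) f \<longleftrightarrow> continuous_on UNIV f \<and>
     (\<forall>x y. (\<lambda>t. f (t, y)) differentiable (at x) \<and> (\<lambda>t. f (x, t)) differentiable (at y)) \<and>
     Ck k (pdx f) \<and> Ck k (pdy f)"

definition smooth_torus :: "(real \<times> real \<Rightarrow> 'b::real_normed_vector) set" where
  "smooth_torus = {f. periodic f \<and> (\<forall>k. Ck k f)}"

abbreviation algA :: "(real \<times> real \<Rightarrow> complex) set" where
  "algA \<equiv> smooth_torus"

definition bounded_ops :: "(l2mat \<Rightarrow> l2mat) set" where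
  "bounded_ops = {T. bounded_linear T \<and> (\<forall>c v. T (c *\<^sub>C v) = c *\<^sub>C T v)}"

text \<open>The adjoint of a bounded operator: unique because \<open>cinner\<close> is nondegenerate, and it exists
  by the Riesz representation theorem because \<open>L\<^sup>2\<close> is complete.\<close>

definition adj :: "(l2mat \<Rightarrow> l2mat) \<Rightarrow> l2mat \<Rightarrow> l2mat" where
  "adj T = (THE S. \<forall>v w. cinner (T v) w = cinner v (S w))"

definition commutant :: "(l2mat \<Rightarrow> l2mat) set \<Rightarrow> (l2mat \<Rightarrow> l2mat) set" where
  "commutant S = {T \<in> bounded_ops. \<forall>\<xi>\<in>S. T \<circ> \<xi> = \<xi> \<circ> T}"

definition op_subspace :: "(l2mat \<Rightarrow> l2mat) set \<Rightarrow> bool" where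
  "op_subspace M \<longleftrightarrow> (\<lambda>v. 0) \<in> M \<and>
     (\<forall>S\<in>M. \<forall>T\<in>M. (\<lambda>v. S v + T v) \<in> M) \<and> (\<forall>c. \<forall>T\<in>M. (\<lambda>v. c *\<^sub>C T v) \<in> M)"

text \<open>The last clause is closedness in the operator norm; no unit is required.\<close>

definition cstar_subalgebra :: "(l2mat \<Rightarrow> l2mat) set \<Rightarrow> bool" where
  "cstar_subalgebra M \<longleftrightarrow> M \<subseteq> bounded_ops \<and> op_subspace M \<and>
     (\<forall>S\<in>M. \<forall>T\<in>M. S \<circ> T \<in> M) \<and> (\<forall>T\<in>M. adj T \<in> M) \<and>
     (\<forall>T\<in>bounded_ops. (\<forall>e>0. \<exists>S\<in>M. onorm (\<lambda>v. S v - T v) < e) \<longrightarrow> T \<in> M)"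

text \<open>The choice of representative made by \<open>rep_l2mat\<close> is immaterial, see \<open>mult_op_abs\<close>.\<close>

definition mult_op :: "(real \<times> real \<Rightarrow> complex) \<Rightarrow> l2mat \<Rightarrow> l2mat" where
  "mult_op f v = abs_l2mat (\<lambda>p. f p *\<^sub>M rep_l2mat v p)"

lemma smooth_torus_continuous: "f \<in> smooth_torus \<Longrightarrow> continuous_on UNIV f"
  by (metis (mono_tags) Ck.simps(1) mem_Collect_eq smooth_torus_def)

lemma space_torus: "space torus = {0..1} \<times> {0..1}"
  by (simp add: torus_def space_restrict_space)

lemma algA_bounded:
  assumes "f \<in> algA"
  obtains B where "B > 0" "\<And>p. p \<in> space torus \<Longrightarrow> cmod (f p) \<le> B"
proof -
  have "compact (f ` space torus)"
    unfolding space_torus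
    by (intro compact_continuous_image continuous_on_subset[OF smooth_torus_continuous[OF assms]] compact_Times) auto
  then show ?thesis
    using that by (metis bounded_pos compact_imp_bounded imageI)
qed

lemma L2_fun_mult:
  assumes f: "f \<in> algA" and F: "L2_fun F"
  shows "L2_fun (\<lambda>p. f p *\<^sub>M F p)"
proof -
  obtain B where B: "B > 0" "\<And>p. p \<in> space torus \<Longrightarrow> cmod (f p) \<le> B"
    using algA_bounded[OF f] by blast
  have "f \<in> borel_measurable borel"
    using smooth_torus_continuous[OF f] by (rule borel_measurable_continuous_onI)
  then have m: "(\<lambda>p. f p *\<^sub>M F p) \<in> borel_measurable borel"
    by (rule borel_measurable_continuous_Pair)
      (use F in \<open>auto simp: L2_fun_def intro!: continuous_intros\<close>)
  have "integrable torus (\<lambda>p. (norm (f p *\<^sub>M F p))\<^sup>2)"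
  proof (rule Bochner_Integration.integrable_bound)
    show "integrable torus (\<lambda>p. B\<^sup>2 * (norm (F p))\<^sup>2)"
      using F by (auto simp: L2_fun_def)
    show "(\<lambda>p. (norm (f p *\<^sub>M F p))\<^sup>2) \<in> borel_measurable torus"
      by (rule measurable_torus) (use m in measurable)
    show "AE p in torus. norm ((norm (f p *\<^sub>M F p))\<^sup>2) \<le> norm (B\<^sup>2 * (norm (F p))\<^sup>2)"
      by (intro AE_I2) (simp add: norm_smult_mat power_mult_distrib mult_right_mono power_mono B)
  qed
  with m show ?thesis
    using f F by (auto simp: L2_fun_def periodic_def smooth_torus_def)
qed

lemma mult_op_abs:
  assumes "f \<in> algA" "L2_fun F"
  shows "mult_op f (abs_l2mat F) = abs_l2mat (\<lambda>p. f p *\<^sub>M F p)"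
proof -
  have "L2_rel F F" using assms by (simp add: L2_rel_def)
  then have "L2_rel (rep_l2mat (abs_l2mat F)) F"
    by (rule Quotient3_rep_abs[OF Quotient3_l2mat])
  then have "L2_rel (\<lambda>p. f p *\<^sub>M rep_l2mat (abs_l2mat F) p) (\<lambda>p. f p *\<^sub>M F p)"
    using assms unfolding L2_rel_def by (auto intro!: L2_fun_mult elim: AE_mp)
  then show ?thesis
    unfolding mult_op_def by (rule Quotient3_rel_abs[OF Quotient3_l2mat])
qed

lemma l2mat_cases:
  obtains F where "L2_fun F" "v = abs_l2mat F"
  using Quotient3_abs_rep[OF Quotient3_l2mat, of v] Quotient3_rep_reflp[OF Quotient3_l2mat, of v]
  by (metis L2_rel_def)

lemma norm_abs_l2mat:
  assumes "L2_fun F"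
  shows "norm (abs_l2mat F) = sqrt (1/2 * (LINT p|torus. (norm (F p))\<^sup>2))"
proof -
  have "cinner (abs_l2mat F) (abs_l2mat F) = 1/2 * (LINT p|torus. trace (ctranspose (F p) ** F p))"
    using assms by (simp add: cinner.abs_eq L2_rel_def)
  also have "\<dots> = of_real (1/2 * (LINT p|torus. (norm (F p))\<^sup>2))"
    by (simp add: trace_ctranspose_self integral_complex_of_real del: of_real_power)
  finally show ?thesis
    by (simp only: norm_eq_sqrt_inner inner_l2mat_def Re_complex_of_real)
qed

lemma mult_op_in_bounded_ops:
  assumes f: "f \<in> algA"
  shows "mult_op f \<in> bounded_ops"
proof -
  obtain B where B: "B > 0" "\<And>p. p \<in> space torus \<Longrightarrow> cmod (f p) \<le> B"
    using algA_bounded[OF f] by blast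
  have "mult_op f (v + w) = mult_op f v + mult_op f w" for v w
  proof -
    obtain F G where "L2_fun F" "v = abs_l2mat F" "L2_fun G" "w = abs_l2mat G"
      by (metis l2mat_cases)
    then show ?thesis
      using f by (simp add: plus_l2mat.abs_eq L2_rel_def mult_op_abs L2_fun_add L2_fun_mult)
        (simp add: smult_mat_def vec_eq_iff distrib_left plus_vec_def)
  qed
  moreover have C: "mult_op f (c *\<^sub>C v) = c *\<^sub>C mult_op f v" for c v
  proof -
    obtain F where "L2_fun F" "v = abs_l2mat F" by (metis l2mat_cases)
    then show ?thesis
      using f by (simp add: scaleC.abs_eq L2_rel_def mult_op_abs L2_fun_smult L2_fun_mult)
        (simp add: smult_mat_def mult.left_commute)
  qed
  moreover have "r *\<^sub>R v = of_real r *\<^sub>C v" for r and v :: l2mat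
  proof -
    obtain F where "L2_fun F" "v = abs_l2mat F" by (metis l2mat_cases)
    moreover have "r *\<^sub>R F p = of_real r *\<^sub>M F p" for F :: "real \<times> real \<Rightarrow> cmat2" and p
      unfolding smult_mat_def by (simp add: vec_eq_iff scaleR_conv_of_real[where 'a=complex])
    ultimately show ?thesis
      by (simp add: scaleC.abs_eq scaleR_l2mat.abs_eq L2_rel_def)
  qed
  moreover have "norm (mult_op f v) \<le> norm v * B" for v
  proof -
    obtain F where F: "L2_fun F" "v = abs_l2mat F" by (metis l2mat_cases)
    have "(LINT p|torus. (norm (f p *\<^sub>M F p))\<^sup>2) \<le> (LINT p|torus. B\<^sup>2 * (norm (F p))\<^sup>2)"
    proof (rule integral_mono)
      show "integrable torus (\<lambda>p. (norm (f p *\<^sub>M F p))\<^sup>2)"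
        using L2_fun_mult[OF f F(1)] by (simp add: L2_fun_def)
      show "integrable torus (\<lambda>p. B\<^sup>2 * (norm (F p))\<^sup>2)"
        using F(1) by (simp add: L2_fun_def)
    qed (simp add: norm_smult_mat power_mult_distrib mult_right_mono power_mono B)
    then have "norm (mult_op f v) \<le> sqrt (B\<^sup>2 * (1/2 * (LINT p|torus. (norm (F p))\<^sup>2)))"
      using F f by (simp add: mult_op_abs norm_abs_l2mat L2_fun_mult del: real_sqrt_mult)
    also have "\<dots> = norm v * B"
      unfolding real_sqrt_mult[of "B\<^sup>2"] F(2) norm_abs_l2mat[OF F(1)] using B(1) by simp
    finally show ?thesis .
  qed
  ultimately show ?thesis
    unfolding bounded_ops_def by (auto intro!: bounded_linear_intro)
qed

definition D0 :: "(real \<times> real \<Rightarrow> cmat2) \<Rightarrow> real \<times> real \<Rightarrow> cmat2" where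
  "D0 F p = \<i> *\<^sub>M (sigma1 ** pdx F p) + \<i> *\<^sub>M (sigma2 ** pdy F p)"

text \<open>\<open>D\<close> is the operator whose graph is the closure of the graph of \<open>D0\<close> on smooth matrix-valued
  functions; \<open>D0\<close> is essentially self-adjoint, hence closable, so \<open>D_graph\<close> is single-valued.\<close>

definition D_graph :: "(l2mat \<times> l2mat) set" where
  "D_graph = closure ((\<lambda>F. (abs_l2mat F, abs_l2mat (D0 F))) ` smooth_torus)"

definition D_dom :: "l2mat set" where
  "D_dom = Domain D_graph"

definition D_op :: "l2mat \<Rightarrow> l2mat" where
  "D_op v = (THE w. (v, w) \<in> D_graph)"

text \<open>\<open>T\<close> is the bounded extension of \<open>[D, b]\<close>; it is determined by its values on the dense
  subspace \<open>D_dom\<close>.\<close>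

definition commutator_ext :: "(real \<times> real \<Rightarrow> complex) \<Rightarrow> (l2mat \<Rightarrow> l2mat) \<Rightarrow> bool" where
  "commutator_ext b T \<longleftrightarrow> T \<in> bounded_ops \<and>
     (\<forall>v\<in>D_dom. mult_op b v \<in> D_dom \<and> T v = D_op (mult_op b v) - mult_op b (D_op v))"

definition one_forms :: "(l2mat \<Rightarrow> l2mat) set" where
  "one_forms = op_subspace hull {mult_op a \<circ> T | a b T. a \<in> algA \<and> b \<in> algA \<and> commutator_ext b T}"

definition Cl_D :: "(l2mat \<Rightarrow> l2mat) set" where
  "Cl_D = cstar_subalgebra hull (mult_op ` algA \<union> one_forms)"

definition antilinear_isometry :: "(l2mat \<Rightarrow> l2mat) \<Rightarrow> bool" where
  "antilinear_isometry J \<longleftrightarrow> (\<forall>v w. J (v + w) = J v + J w) \<and>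
     (\<forall>c v. J (c *\<^sub>C v) = cnj c *\<^sub>C J v) \<and> (\<forall>v. norm (J v) = norm v)"

definition opp :: "(l2mat \<Rightarrow> l2mat) \<Rightarrow> (l2mat \<Rightarrow> l2mat) \<Rightarrow> l2mat \<Rightarrow> l2mat" where
  "opp J \<xi> = J \<circ> adj \<xi> \<circ> inv J"

end

theory Submission
  imports Defs
begin

text \<open>Put \<open>e = exp (2 \<pi> i x)\<close>, \<open>T = [D, e] = -2 \<pi> L\<^bsub>\<sigma>\<^sub>1\<^esub> e\<close>, \<open>F = J\<inverse> e J\<close> and \<open>H = J\<inverse> T J\<close>.
  Since \<open>J\<close> intertwines \<open>D\<close> up to a sign, \<open>[D, F] = \<plusminus>H\<close> holds weakly, i.e. when paired with vectors of the
  domain; this needs only that \<open>D\<close> is symmetric. By the second-order condition \<open>F\<close> and \<open>H\<close> commute with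
  the left multiplications by \<open>\<sigma>\<^sub>1\<close> and \<open>\<sigma>\<^sub>2\<close>. Apply this to a constant matrix \<open>p\<close>: commuting
  \<open>D F p = \<plusminus>H p\<close> with \<open>\<sigma>\<^sub>1\<close> and \<open>\<sigma>\<^sub>2\<close> kills both weak partial derivatives of \<open>F p\<close>, because
  \<open>\<sigma>\<^sub>1\<close> and \<open>\<sigma>\<^sub>2\<close> anticommute. Hence \<open>H p = 0\<close> by density of the smooth functions, although \<open>H\<close> is
  injective.\<close>

section \<open>Smooth functions on the torus\<close>

lemma Ck_Suc_imp_Ck: "Ck (Suc k) f \<Longrightarrow> Ck k f"
proof (induction k arbitrary: f)
  case (Suc k)
  from Suc.prems show ?case
    unfolding Ck.simps(2)[of "Suc k" f] Ck.simps(2)[of k f] using Suc.IH by blast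
qed simp

lemma pdx_eqI:
  "(\<And>x y. ((\<lambda>t. f (t, y)) has_vector_derivative g (x, y)) (at x)) \<Longrightarrow> pdx f = g"
  by (auto simp: pdx_def intro!: ext vector_derivative_at)

lemma pdy_eqI:
  "(\<And>x y. ((\<lambda>t. f (x, t)) has_vector_derivative g (x, y)) (at y)) \<Longrightarrow> pdy f = g"
  by (auto simp: pdy_def intro!: ext vector_derivative_at)

lemma Ck_Suc_has_derivative:
  assumes "Ck (Suc k) f"
  shows "((\<lambda>t. f (t, y)) has_vector_derivative pdx f (x, y)) (at x)"
    and "((\<lambda>t. f (x, t)) has_vector_derivative pdy f (x, y)) (at y)"
  using assms by (auto simp: pdx_def pdy_def vector_derivative_works)

text \<open>\<open>pdx\<close> and \<open>pdy\<close> are chosen by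
  \<open>vector_derivative\<close>. Exhibiting candidate derivatives identifies them by uniqueness,
  so the inductions below work with explicit formulas.\<close>

lemma Ck_SucI:
  assumes "\<And>x y. ((\<lambda>t. f (t, y)) has_vector_derivative g (x, y)) (at x)"
    and "\<And>x y. ((\<lambda>t. f (x, t)) has_vector_derivative h (x, y)) (at y)"
    and "continuous_on UNIV f" "Ck k g" "Ck k h"
  shows "Ck (Suc k) f"
  using assms(3-5) pdx_eqI[OF assms(1)] pdy_eqI[OF assms(2)]
    differentiableI_vector[OF assms(1)] differentiableI_vector[OF assms(2)]
  by simp

lemma Ck_add:
  "Ck k f \<Longrightarrow> Ck k g \<Longrightarrow> Ck k (\<lambda>p. f p + g p)"
proof (induction k arbitrary: f g)
  case 0
  then show ?case by (auto intro: continuous_intros)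
next
  case (Suc k)
  show ?case
    by (rule Ck_SucI[where g = "\<lambda>p. pdx f p + pdx g p" and h = "\<lambda>p. pdy f p + pdy g p"])
      (use Suc.prems in \<open>auto intro!: derivative_intros Ck_Suc_has_derivative Suc.IH continuous_intros\<close>)
qed

text \<open>One Leibniz argument covers products, inner products and the scalar action on matrices.
  The induction varies \<open>f\<close> and \<open>g\<close>, since the derivative is a sum of
  products of other functions.\<close>

lemma Ck_bilinear:
  assumes "bounded_bilinear h"
  shows "Ck k f \<Longrightarrow> Ck k g \<Longrightarrow> Ck k (\<lambda>p. h (f p) (g p))"
proof (induction k arbitrary: f g)
  case 0
  then show ?case by (auto intro: bounded_bilinear.continuous_on[OF assms])
next
  case (Suc k)
  show ?case
  proof (rule Ck_SucI[where g = "\<lambda>p. h (f p) (pdx g p) + h (pdx f p) (g p)"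
        and h = "\<lambda>p. h (f p) (pdy g p) + h (pdy f p) (g p)"])
    have "Ck k f" "Ck k g" "Ck k (pdx f)" "Ck k (pdx g)" "Ck k (pdy f)" "Ck k (pdy g)"
      using Suc.prems Ck_Suc_imp_Ck by auto
    then show "Ck k (\<lambda>p. h (f p) (pdx g p) + h (pdx f p) (g p))"
      "Ck k (\<lambda>p. h (f p) (pdy g p) + h (pdy f p) (g p))"
      by (auto intro: Ck_add Suc.IH)
  qed (use Suc.prems in \<open>auto intro: bounded_bilinear.continuous_on[OF assms]
      intro!: bounded_bilinear.has_vector_derivative[OF assms] Ck_Suc_has_derivative\<close>)
qed

lemma Ck_linear:
  assumes "bounded_linear h"
  shows "Ck k f \<Longrightarrow> Ck k (\<lambda>p. h (f p))"
proof (induction k arbitrary: f)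
  case 0
  then show ?case by (auto intro: bounded_linear.continuous_on[OF assms])
next
  case (Suc k)
  show ?case
    by (rule Ck_SucI[where g = "\<lambda>p. h (pdx f p)" and h = "\<lambda>p. h (pdy f p)"])
      (use Suc.prems in \<open>auto intro: bounded_linear.continuous_on[OF assms]
      intro!: bounded_linear.has_vector_derivative[OF assms] Ck_Suc_has_derivative Suc.IH\<close>)
qed

lemma Ck_const: "Ck k (\<lambda>p. c)"
proof (induction k arbitrary: c)
  case (Suc k)
  show ?case by (rule Ck_SucI[where g = "\<lambda>p. 0" and h = "\<lambda>p. 0"]) (auto intro: Suc)
qed simp

lemma has_vector_derivative_cis_affine:
  "((\<lambda>t. c * cis (a * t + b)) has_vector_derivative (\<i> * of_real a * c) * cis (a * x + b)) (at x)"
proof -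
  have "((\<lambda>z. c * exp (\<i> * (of_real a * z + of_real b))) has_field_derivative
      (\<i> * of_real a * c) * exp (\<i> * (of_real a * of_real x + of_real b))) (at (of_real x))"
    by (auto intro!: derivative_eq_intros)
  from has_vector_derivative_real_field[OF this] show ?thesis
    by (simp add: cis_conv_exp)
qed

lemma Ck_cis: "Ck k (\<lambda>p. c * cis (a * fst p + b * snd p))"
proof (induction k arbitrary: c)
  case 0
  show ?case by (auto intro!: continuous_intros)
next
  case (Suc k)
  show ?case
  proof (rule Ck_SucI)
    show "((\<lambda>t. c * cis (a * fst (t, y) + b * snd (t, y))) has_vector_derivative
        (\<lambda>p. (\<i> * of_real a * c) * cis (a * fst p + b * snd p)) (x, y)) (at x)" for x y
      using has_vector_derivative_cis_affine[of c a "b * y" x] by simp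
    show "((\<lambda>t. c * cis (a * fst (x, t) + b * snd (x, t))) has_vector_derivative
        (\<lambda>p. (\<i> * of_real b * c) * cis (a * fst p + b * snd p)) (x, y)) (at y)" for x y
      using has_vector_derivative_cis_affine[of c b "a * x" y] by (simp add: add.commute)
  qed (auto intro!: continuous_intros Suc)
qed

lemma smooth_torus_add: "f \<in> smooth_torus \<Longrightarrow> g \<in> smooth_torus \<Longrightarrow> (\<lambda>p. f p + g p) \<in> smooth_torus"
  by (auto simp: smooth_torus_def periodic_def Ck_add)

lemma smooth_torus_bilinear:
  "bounded_bilinear h \<Longrightarrow> f \<in> smooth_torus \<Longrightarrow> g \<in> smooth_torus \<Longrightarrow> (\<lambda>p. h (f p) (g p)) \<in> smooth_torus"
  by (auto simp: smooth_torus_def periodic_def Ck_bilinear)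

lemma smooth_torus_linear:
  "bounded_linear h \<Longrightarrow> f \<in> smooth_torus \<Longrightarrow> (\<lambda>p. h (f p)) \<in> smooth_torus"
  by (auto simp: smooth_torus_def periodic_def Ck_linear)

lemma smooth_torus_const: "(\<lambda>p. c) \<in> smooth_torus"
  by (auto simp: smooth_torus_def periodic_def Ck_const)

lemma smooth_torus_has_derivative:
  assumes "f \<in> smooth_torus"
  shows "((\<lambda>t. f (t, y)) has_vector_derivative pdx f (x, y)) (at x)"
    and "((\<lambda>t. f (x, t)) has_vector_derivative pdy f (x, y)) (at y)"
  using assms Ck_Suc_has_derivative[of 0 f] by (auto simp: smooth_torus_def)

lemma smooth_torus_pd:
  assumes "f \<in> smooth_torus"
  shows "pdx f \<in> smooth_torus" "pdy f \<in> smooth_torus"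
proof -
  have C: "Ck k (pdx f)" "Ck k (pdy f)" for k
    using assms Ck.simps(2)[of k f] by (auto simp: smooth_torus_def simp del: Ck.simps)
  have p: "f (x + 1, y) = f (x, y)" "f (x, y + 1) = f (x, y)" for x y
    using assms by (auto simp: smooth_torus_def periodic_def)
  \<comment> \<open>The chain rule for the shift \<open>t + 1\<close> moves the derivative at
    \<open>x + 1\<close> back to \<open>x\<close>, and periodicity removes the shift from the
    function. Uniqueness of derivatives then makes the partial derivative periodic in its own
    variable.\<close>
  have "((\<lambda>t. f (t, y)) has_vector_derivative pdx f (x + 1, y)) (at x)"
    "((\<lambda>t. f (x, t)) has_vector_derivative pdy f (x, y + 1)) (at y)" for x y
    using vector_diff_chain_at[of "\<lambda>t. t + 1" 1 x "\<lambda>t. f (t, y)" "pdx f (x + 1, y)"]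
      vector_diff_chain_at[of "\<lambda>t. t + 1" 1 y "\<lambda>t. f (x, t)" "pdy f (x, y + 1)"]
      smooth_torus_has_derivative[OF assms]
    by (auto simp: o_def p has_vector_derivative_add_const)
  then have "pdx f (x + 1, y) = pdx f (x, y)" "pdy f (x, y + 1) = pdy f (x, y)" for x y
    using smooth_torus_has_derivative[OF assms] vector_derivative_unique_at by blast+
  moreover have "pdx f (x, y + 1) = pdx f (x, y)" "pdy f (x + 1, y) = pdy f (x, y)" for x y
    by (simp_all add: pdx_def pdy_def p)
  ultimately show "pdx f \<in> smooth_torus" "pdy f \<in> smooth_torus"
    using C by (auto simp: smooth_torus_def periodic_def)
qed

lemma pd_bilinear:
  assumes "bounded_bilinear h" "f \<in> smooth_torus" "g \<in> smooth_torus"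
  shows "pdx (\<lambda>p. h (f p) (g p)) = (\<lambda>p. h (f p) (pdx g p) + h (pdx f p) (g p))"
    and "pdy (\<lambda>p. h (f p) (g p)) = (\<lambda>p. h (f p) (pdy g p) + h (pdy f p) (g p))"
  by (intro pdx_eqI pdy_eqI bounded_bilinear.has_vector_derivative[OF assms(1)]
      smooth_torus_has_derivative assms(2,3))+

lemma pd_linear:
  assumes "bounded_linear h" "f \<in> smooth_torus"
  shows "pdx (\<lambda>p. h (f p)) = (\<lambda>p. h (pdx f p))" "pdy (\<lambda>p. h (f p)) = (\<lambda>p. h (pdy f p))"
  by (intro pdx_eqI pdy_eqI bounded_linear.has_vector_derivative[OF assms(1)]
      smooth_torus_has_derivative assms(2))+

lemma pd_const: "pdx (\<lambda>p. c) = (\<lambda>p. 0)" "pdy (\<lambda>p. c) = (\<lambda>p. 0)"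
  by (auto intro!: pdx_eqI pdy_eqI)

section \<open>Fourier modes, the characters of the torus\<close>

definition mode :: "int \<Rightarrow> int \<Rightarrow> real \<times> real \<Rightarrow> complex" where
  "mode m n p = cis (2 * pi * m * fst p + 2 * pi * n * snd p)"

lemma mode_smooth: "mode m n \<in> smooth_torus"
proof -
  have "cis (t + 2 * pi * of_int k) = cis t" for t k
    by (simp add: cis_mult[symmetric])
  from this[of "2 * pi * m * _ + 2 * pi * n * _" m] this[of "2 * pi * m * _ + 2 * pi * n * _" n]
  have "periodic (mode m n)"
    by (simp add: periodic_def mode_def algebra_simps)
  moreover have "Ck k (mode m n)" for k
    using Ck_cis[of k 1] unfolding mode_def by simp
  ultimately show ?thesis by (simp add: smooth_torus_def)
qed

lemma pd_mode:
  "pdx (mode m n) = (\<lambda>p. 2 * pi * m * \<i> * mode m n p)"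
  "pdy (mode m n) = (\<lambda>p. 2 * pi * n * \<i> * mode m n p)"
proof -
  show "pdx (mode m n) = (\<lambda>p. 2 * pi * m * \<i> * mode m n p)"
    using has_vector_derivative_cis_affine[of 1 "2 * pi * m" "2 * pi * n * _"]
    by (intro pdx_eqI) (simp add: mode_def mult_ac)
  show "pdy (mode m n) = (\<lambda>p. 2 * pi * n * \<i> * mode m n p)"
    using has_vector_derivative_cis_affine[of 1 "2 * pi * n" "2 * pi * m * _"]
    by (intro pdy_eqI) (simp add: mode_def mult_ac add.commute)
qed

lemma mode_mult: "mode m n p * mode m' n' p = mode (m + m') (n + n') p"
  by (simp add: mode_def cis_mult algebra_simps)

lemma mode_zero [simp]: "mode 0 0 p = 1"
  by (simp add: mode_def)

section \<open>Density of smooth functions\<close>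

lemma smooth_torus_real_polynomial:
  fixes \<phi> :: "real \<times> real \<Rightarrow> real"
  assumes "real_polynomial_function q" "\<phi> \<in> smooth_torus"
  shows "(\<lambda>p. q (\<phi> p)) \<in> smooth_torus"
  using assms(1)
  by induction (auto intro: smooth_torus_linear assms(2) smooth_torus_const smooth_torus_add
      smooth_torus_bilinear[OF bounded_bilinear_mult])

text \<open>A trigonometric polynomial of period 1 that is positive exactly on \<open>(a, b)\<close> within \<open>[0, 1]\<close>:
  composed with polynomials approximating a step function, it gives smooth periodic functions that
  converge boundedly to the indicator of \<open>(a, b)\<close>.\<close>

definition arc :: "real \<Rightarrow> real \<Rightarrow> real \<Rightarrow> real" where
  "arc a b x = 2 * sin (pi * (x - a)) * sin (pi * (b - x))"

text \<open>Each sine factor merely changes sign under \<open>x + 1\<close>. The product-to-sum form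
  shows the period 1 and exhibits \<open>arc\<close> as the real part of a rotated Fourier mode plus
  a constant.\<close>

lemma arc_eq_cos: "arc a b x = cos (2 * pi * x - pi * (a + b)) - cos (pi * (b - a))"
  unfolding arc_def cos_diff_cos by (simp add: algebra_simps diff_divide_distrib add_divide_distrib)

lemma abs_arc_le: "\<bar>arc a b x\<bar> \<le> 2"
  using mult_mono[OF abs_sin_le_one[of "pi * (x - a)"] abs_sin_le_one[of "pi * (b - x)"]]
  by (simp add: arc_def abs_mult)

text \<open>Both \<open>x - a\<close> and \<open>b - x\<close> lie in [-1, 1], where
  \<open>sin (pi * u)\<close> is nonnegative for u \<ge> 0 and nonpositive for u \<le> 0. Outside
  the interval the two factors therefore have opposite weak signs.\<close>

lemma arc_pos_iff:
  assumes "x \<in> {0..1}" "0 \<le> a" "a \<le> b" "b \<le> 1"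
  shows "arc a b x > 0 \<longleftrightarrow> x \<in> {a<..<b}"
proof -
  have pos: "sin (pi * u) > 0" if "0 < u" "u < 1" for u
    using that by (intro sin_gt_zero) auto
  have nonneg: "sin (pi * u) \<ge> 0" if "0 \<le> u" "u \<le> 1" for u
    using that by (intro sin_ge_zero) (auto simp: mult_left_le)
  have nonpos: "sin (pi * u) \<le> 0" if "-1 \<le> u" "u \<le> 0" for u
    using nonneg[of "-u"] that by simp
  consider "x \<le> a" | "b \<le> x" | "a < x" "x < b" by linarith
  then show ?thesis
  proof cases
    case 1
    then have "sin (pi * (x - a)) \<le> 0" "sin (pi * (b - x)) \<ge> 0"
      using assms by (auto intro!: nonneg nonpos)
    then show ?thesis using 1 by (auto simp: arc_def zero_less_mult_iff)
  next
    case 2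
    then have "sin (pi * (x - a)) \<ge> 0" "sin (pi * (b - x)) \<le> 0"
      using assms by (auto intro!: nonneg nonpos)
    then show ?thesis using 2 by (auto simp: arc_def zero_less_mult_iff)
  next
    case 3
    then have "sin (pi * (x - a)) > 0" "sin (pi * (b - x)) > 0"
      using assms by (auto intro!: pos)
    then show ?thesis using 3 by (auto simp: arc_def)
  qed
qed

lemma arc_smooth:
  "(\<lambda>p. arc a b (fst p)) \<in> smooth_torus" "(\<lambda>p. arc a b (snd p)) \<in> smooth_torus"
proof -
  have "bounded_linear (\<lambda>z. Re (cis (- pi * (a + b)) * z))"
    by (intro bounded_linear_compose[OF bounded_linear_Re] bounded_linear_mult_right)
  note S = smooth_torus_add[OF smooth_torus_linear[OF this mode_smooth] smooth_torus_const]
  show "(\<lambda>p. arc a b (fst p)) \<in> smooth_torus" "(\<lambda>p. arc a b (snd p)) \<in> smooth_torus"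
    using S[of 1 0 "- cos (pi * (b - a))"] S[of 0 1 "- cos (pi * (b - a))"]
    unfolding mode_def cis_mult by (simp_all add: arc_eq_cos)
qed

text \<open>The ramps \<open>r n\<close> converge pointwise to the step, with value 0 at 0, and
  Weierstrass approximates the n-th ramp within 1/(n+1). The range [-2, 2] is that of
  \<open>arc\<close>; the bound 2 is 1 for the ramp plus 1 for the error.\<close>

lemma polynomial_approx_step:
  obtains q :: "nat \<Rightarrow> real \<Rightarrow> real" where "\<And>n. real_polynomial_function (q n)"
    "\<And>n s. \<bar>s\<bar> \<le> 2 \<Longrightarrow> \<bar>q n s\<bar> \<le> 2"
    "\<And>s. \<bar>s\<bar> \<le> 2 \<Longrightarrow> (\<lambda>n. q n s) \<longlonglongrightarrow> indicator {0<..} s"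
proof -
  define r where "r n s = min 1 (max 0 (real n * s))" for n s
  have "\<exists>q. real_polynomial_function q \<and> (\<forall>s\<in>{-2..2}. \<bar>r n s - q s\<bar> < 1 / real (Suc n))" for n
  proof -
    have "continuous_on {-2..2} (r n)"
      unfolding r_def by (intro continuous_intros)
    moreover have "0 < 1 / real (Suc n)" by simp
    ultimately show ?thesis
      by (meson Stone_Weierstrass_real_polynomial_function compact_Icc)
  qed
  then obtain q where q: "\<And>n. real_polynomial_function (q n)"
    "\<And>n s. s \<in> {-2..2} \<Longrightarrow> \<bar>r n s - q n s\<bar> < 1 / real (Suc n)" by metis
  have "\<bar>q n s\<bar> \<le> 2" if "\<bar>s\<bar> \<le> 2" for n s
  proof -
    have "\<bar>r n s - q n s\<bar> < 1"
      using that by (intro less_le_trans[OF q(2)]) auto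
    moreover have "0 \<le> r n s" "r n s \<le> 1" by (auto simp: r_def)
    ultimately show ?thesis by linarith
  qed
  moreover have "(\<lambda>n. q n s) \<longlonglongrightarrow> indicator {0<..} s" if "\<bar>s\<bar> \<le> 2" for s
  proof -
    have "\<bar>q n s - r n s\<bar> \<le> 1 / real (Suc n)" for n
      using less_imp_le[OF q(2)[of s n]] that by (subst abs_minus_commute) (simp only: abs_le_iff atLeastAtMost_iff minus_le_iff)
    then have "(\<lambda>n. q n s - r n s) \<longlonglongrightarrow> 0"
      by (intro Lim_null_comparison[OF _ LIMSEQ_inverse_real_of_nat])
        (simp add: inverse_eq_divide del: of_nat_Suc)
    moreover have "(\<lambda>n. r n s) \<longlonglongrightarrow> indicator {0<..} s"
    proof (cases "s > 0")
      case True
      then have "eventually (\<lambda>n. real n * s \<ge> 1) sequentially"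
        by real_asymp
      then have "eventually (\<lambda>n. r n s = 1) sequentially"
        by eventually_elim (auto simp: r_def)
      with True show ?thesis by (simp add: tendsto_eventually)
    next
      case False
      then have "r n s = 0" for n
        by (auto simp: r_def max_def mult_le_0_iff zero_le_mult_iff)
      with False show ?thesis by simp
    qed
    ultimately show ?thesis by (rule Lim_transform[rotated])
  qed
  ultimately show ?thesis using that q(1) by blast
qed

section \<open>Integration over the unit square\<close>

lemma integrable_torus_iff:
  fixes f :: "real \<times> real \<Rightarrow> 'b::{banach, second_countable_topology}"
  shows "integrable torus f \<longleftrightarrow> integrable lborel (\<lambda>p. indicator ({0..1} \<times> {0..1}) p *\<^sub>R f p)"
  unfolding torus_def by (rule integrable_restrict_space) (simp add: closed_Times borel_closed)

lemma integral_torus: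
  fixes f :: "real \<times> real \<Rightarrow> 'b::{banach, second_countable_topology}"
  shows "(LINT p|torus. f p) = (LINT p:{0..1} \<times> {0..1}|lborel. f p)"
  unfolding torus_def set_lebesgue_integral_def
  by (rule integral_restrict_space) (simp add: closed_Times borel_closed)

lemma continuous_integrable_torus:
  fixes f :: "real \<times> real \<Rightarrow> 'b::{banach, second_countable_topology}"
  shows "continuous_on UNIV f \<Longrightarrow> integrable torus f"
  unfolding integrable_torus_iff
  by (intro borel_integrable_compact compact_Times) (auto intro: continuous_on_subset)

lemma AE_torus_interior: "AE p in torus. p \<in> {0<..<1} \<times> {0<..<1}"
proof -
  have "cbox (0, 0) (1 :: real, 1 :: real) - box (0, 0) (1 :: real, 1 :: real) \<in> null_sets lborel"
    using negligible_frontier_interval[of "(0, 0)" "(1 :: real, 1 :: real)"]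
    unfolding negligible_iff_null_sets by (auto simp: null_sets_completion_iff)
  then have "AE p in lborel. p \<notin> cbox (0, 0) (1 :: real, 1 :: real) - box (0, 0) (1 :: real, 1 :: real)"
    by (rule AE_not_in)
  then have "AE p in lborel. p \<in> {0..1} \<times> {0..1} \<longrightarrow> p \<in> {0<..<1 :: real} \<times> {0<..<1 :: real}"
    by eventually_elim (auto simp: mem_box Basis_prod_def cbox_def)
  then show ?thesis
    unfolding torus_def by (subst AE_restrict_space_iff) (simp_all add: closed_Times borel_closed)
qed

text \<open>The signed measure with density \<open>h\<close> vanishes on open rectangles, whose
  indicators are bounded limits of smooth periodic functions. Open boxes are stable under
  intersection and generate the Borel sets, so it vanishes on every Borel set, which forces the
  density to be zero.\<close>

lemma AE_zero_if_orthogonal_smooth: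
  fixes h :: "real \<times> real \<Rightarrow> real"
  assumes h: "integrable torus h"
    and orth: "\<And>\<phi>. \<phi> \<in> smooth_torus \<Longrightarrow> (LINT p|torus. \<phi> p * h p) = 0"
  shows "AE p in torus. h p = 0"
proof -
  obtain q :: "nat \<Rightarrow> real \<Rightarrow> real" where q: "\<And>n. real_polynomial_function (q n)"
    "\<And>n s. \<bar>s\<bar> \<le> 2 \<Longrightarrow> \<bar>q n s\<bar> \<le> 2"
    "\<And>s. \<bar>s\<bar> \<le> 2 \<Longrightarrow> (\<lambda>n. q n s) \<longlonglongrightarrow> indicator {0<..} s"
    using polynomial_approx_step by blast
  have rect: "(LINT p|torus. indicator ({a<..<b} \<times> {c<..<d}) p * h p) = 0"
    if ab: "0 \<le> a" "a \<le> b" "b \<le> 1" and cd: "0 \<le> c" "c \<le> d" "d \<le> 1" for a b c d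
  proof -
    \<comment> \<open>A product of one approximate indicator per coordinate; each factor is bounded
      by 2, hence the dominating function \<open>4 * norm (h p)\<close>.\<close>
    define \<phi> where "\<phi> n p = q n (arc a b (fst p)) * q n (arc c d (snd p))" for n p
    have sm: "\<phi> n \<in> smooth_torus" for n
      unfolding \<phi>_def
      by (rule smooth_torus_bilinear[OF bounded_bilinear_mult
            smooth_torus_real_polynomial[OF q(1) arc_smooth(1)]
            smooth_torus_real_polynomial[OF q(1) arc_smooth(2)]])
    have "(\<lambda>n. LINT p|torus. \<phi> n p * h p) \<longlonglongrightarrow> (LINT p|torus. indicator ({a<..<b} \<times> {c<..<d}) p * h p)"
    proof (rule integral_dominated_convergence)
      show "(\<lambda>p. indicator ({a<..<b} \<times> {c<..<d}) p * h p) \<in> borel_measurable torus"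
        by (intro borel_measurable_times borel_measurable_integrable[OF h] measurable_torus
            borel_measurable_indicator) (simp add: open_Times borel_open)
      show "(\<lambda>p. \<phi> n p * h p) \<in> borel_measurable torus" for n
        by (intro borel_measurable_times borel_measurable_integrable[OF h] measurable_torus
            borel_measurable_continuous_onI smooth_torus_continuous sm)
      show "integrable torus (\<lambda>p. 4 * norm (h p))" using h by auto
      show "AE p in torus. norm (\<phi> n p * h p) \<le> 4 * norm (h p)" for n
      proof (intro AE_I2)
        fix p
        have "\<bar>\<phi> n p\<bar> \<le> 2 * 2"
          unfolding \<phi>_def abs_mult by (intro mult_mono q(2) abs_arc_le) auto
        then show "norm (\<phi> n p * h p) \<le> 4 * norm (h p)"
          unfolding real_norm_def abs_mult by (intro mult_right_mono) auto
      qed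
      show "AE p in torus. (\<lambda>n. \<phi> n p * h p) \<longlonglongrightarrow> indicator ({a<..<b} \<times> {c<..<d}) p * h p"
      proof (intro AE_I2 tendsto_mult tendsto_const)
        fix p assume "p \<in> space torus"
        then have "fst p \<in> {0..1}" "snd p \<in> {0..1}" by (auto simp: space_torus)
        then have "indicator ({a<..<b} \<times> {c<..<d}) p =
            (indicator {0<..} (arc a b (fst p)) * indicator {0<..} (arc c d (snd p)) :: real)"
          using arc_pos_iff[of "fst p" a b] arc_pos_iff[of "snd p" c d] ab cd
          by (cases p) (auto simp: indicator_def)
        then show "(\<lambda>n. \<phi> n p) \<longlonglongrightarrow> indicator ({a<..<b} \<times> {c<..<d}) p"
          unfolding \<phi>_def by (auto intro!: tendsto_mult q(3) abs_arc_le)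
      qed
    qed
    then show ?thesis using orth[OF sm] by (simp add: LIMSEQ_const_iff)
  qed
  define g where "g p = indicator ({0..1} \<times> {0..1}) p * h p" for p
  have g: "integrable lborel g"
    using h unfolding integrable_torus_iff g_def by simp
  have LINT_g: "(LINT p:A|lborel. g p) = (LINT p|torus. indicator A p * h p)" for A
    unfolding integral_torus set_lebesgue_integral_def g_def by (simp add: mult.left_commute)
  have box: "(LINT p:box u v|lborel. g p) = 0" for u v
  proof -
    obtain a c b d where [simp]: "u = (a, c)" "v = (b, d)" by (metis surj_pair)
    \<comment> \<open>The box is clipped to the unit square so that \<open>rect\<close> applies;
      taking \<open>max a'\<close> and \<open>max c'\<close> turns reversed intervals into empty
      ones. On the open square, hence almost everywhere, membership is unchanged.\<close>
    define a' b' c' d' where "a' = max 0 (min 1 a)" and "b' = max a' (min 1 b)"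
      and "c' = max 0 (min 1 c)" and "d' = max c' (min 1 d)"
    have bd: "0 \<le> a'" "a' \<le> b'" "b' \<le> 1" "0 \<le> c'" "c' \<le> d'" "d' \<le> 1"
      by (auto simp: a'_def b'_def c'_def d'_def)
    have clip: "a < x \<and> x < b \<longleftrightarrow> a' < x \<and> x < b'" "c < x \<and> x < d \<longleftrightarrow> c' < x \<and> x < d'"
      if "0 < x" "x < 1" for x
      using that unfolding a'_def b'_def c'_def d'_def max_def min_def by auto
    have "AE p in torus. indicator (box u v) p * h p = indicator ({a'<..<b'} \<times> {c'<..<d'}) p * h p"
      using AE_torus_interior
    proof eventually_elim
      case (elim p)
      then have "p \<in> box u v \<longleftrightarrow> p \<in> {a'<..<b'} \<times> {c'<..<d'}"
        using clip(1)[of "fst p"] clip(2)[of "snd p"]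
        by (cases p) (auto simp: mem_box Basis_prod_def)
      then show ?case by (simp add: indicator_def)
    qed
    moreover have "(\<lambda>p. indicator (box u v) p * h p) \<in> borel_measurable torus"
      "(\<lambda>p. indicator ({a'<..<b'} \<times> {c'<..<d'}) p * h p) \<in> borel_measurable torus"
      by (intro borel_measurable_times borel_measurable_integrable[OF h] measurable_torus
            borel_measurable_indicator; simp add: open_Times borel_open)+
    ultimately show ?thesis
      unfolding LINT_g by (subst integral_cong_AE) (assumption+, rule rect[OF bd])
  qed
  have all: "(LINT p:A|lborel. g p) = 0" if A: "A \<in> sets borel" for A
  proof -
    let ?E = "range (\<lambda>(a, b). box a b) :: (real \<times> real) set set"
    have E: "sigma_sets UNIV ?E = sets borel" by (simp add: borel_eq_box)
    have si: "set_integrable lborel B g" if "B \<in> sets borel" for B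
      unfolding set_integrable_def using that g by (intro integrable_mult_indicator) auto
    have "Int_stable ?E" "?E \<subseteq> Pow UNIV" "A \<in> sigma_sets UNIV ?E"
      using A E by (auto simp: Int_stable_def box_Int_box)
    then show ?thesis
    proof (induction rule: sigma_sets_induct_disjoint)
      case (compl A)
      then have A: "A \<in> sets borel" using E by simp
      have "(LINT p:UNIV|lborel. g p) = (LINT p:A \<union> (UNIV - A)|lborel. g p)" by simp
      also have "\<dots> = (LINT p:A|lborel. g p) + (LINT p:UNIV - A|lborel. g p)"
        using A by (intro set_integral_Un si) auto
      \<comment> \<open>The total integral of \<open>g\<close> vanishes by testing against the
        constant function 1.\<close>
      finally show ?case
        using compl orth[OF smooth_torus_const[of 1]] by (simp add: LINT_g)
    next
      case (union A)
      then have "range A \<subseteq> sets borel" using E by simp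
      then have "(LINT p:(\<Union>i. A i)|lborel. g p) = (\<Sum>i. LINT p:A i|lborel. g p)"
        using union(1) by (intro lebesgue_integral_countable_add si) (auto simp: disjoint_family_on_def)
      then show ?case using union by simp
    qed (use box in \<open>auto simp: set_lebesgue_integral_def\<close>)
  qed
  have "AE p in lborel. g p = 0"
    by (rule density_unique_real) (use g all in \<open>auto simp: set_lebesgue_integral_def\<close>)
  then have "AE p in lborel. p \<in> {0..1} \<times> {0..1} \<longrightarrow> h p = 0"
    by eventually_elim (auto simp: g_def)
  then show ?thesis
    unfolding torus_def by (subst AE_restrict_space_iff) (simp_all add: closed_Times borel_closed)
qed

text \<open>Integrating first in the variable of differentiation, the fundamental theorem of
  calculus leaves a difference of boundary values, which cancel by periodicity. Applied to a product
  this is integration by parts on the torus.\<close>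

lemma integral_torus_pd:
  fixes f :: "real \<times> real \<Rightarrow> real"
  assumes f: "f \<in> smooth_torus"
  shows "(LINT p|torus. pdx f p) = 0" "(LINT p|torus. pdy f p) = 0"
proof -
  have *: "(LINT p|torus. g p) = integral (cbox (0, 0) (1 :: real, 1 :: real)) g"
    if g: "continuous_on UNIV g" for g :: "real \<times> real \<Rightarrow> real"
  proof -
    have "set_integrable lborel ({0..1} \<times> {0..1}) g"
      using continuous_integrable_torus[OF g]
      unfolding integrable_torus_iff set_integrable_def .
    moreover have "{0..1} \<times> {0..1 :: real} = cbox (0, 0) (1 :: real, 1 :: real)"
      by (auto simp: cbox_Pair_eq)
    ultimately show ?thesis
      unfolding integral_torus by (simp add: set_borel_integral_eq_integral)
  qed
  have c: "continuous_on A (pdx f)" "continuous_on A (pdy f)" for A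
    using smooth_torus_pd[OF f] smooth_torus_continuous continuous_on_subset by blast+
  have p: "f (1, y) = f (0, y)" "f (x, 1) = f (x, 0)" for x y
  proof -
    have "f (0 + 1, y) = f (0, y)" "f (x, 0 + 1) = f (x, 0)"
      using f unfolding smooth_torus_def periodic_def by blast+
    then show "f (1, y) = f (0, y)" "f (x, 1) = f (x, 0)" by simp_all
  qed
  \<comment> \<open>The iterated integral comes with the y-integral inside, so the x-derivative
    calls for exchanging the order.\<close>
  have "continuous_on (cbox (0, 0) (1, 1)) (\<lambda>(x, y). pdx f (x, y))"
    using c(1) by (simp add: split_beta)
  note swap = integral_swap_continuous[OF this]
  have "((\<lambda>x. pdx f (x, y)) has_integral (f (1, y) - f (0, y))) {0..1}" for y
    by (rule fundamental_theorem_of_calculus)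
      (simp, rule has_vector_derivative_at_within, rule smooth_torus_has_derivative(1)[OF f])
  then have "integral {0..1} (\<lambda>x. pdx f (x, y)) = 0" for y
    unfolding p by (simp add: integral_unique)
  then show "(LINT p|torus. pdx f p) = 0"
    unfolding *[OF c(1)] integral_prod_continuous[OF c(1)] swap by simp
  have "((\<lambda>y. pdy f (x, y)) has_integral (f (x, 1) - f (x, 0))) {0..1}" for x
    by (rule fundamental_theorem_of_calculus)
      (simp, rule has_vector_derivative_at_within, rule smooth_torus_has_derivative(2)[OF f])
  then have "integral {0..1} (\<lambda>y. pdy f (x, y)) = 0" for x
    unfolding p by (simp add: integral_unique)
  then show "(LINT p|torus. pdy f p) = 0"
    unfolding *[OF c(2)] integral_prod_continuous[OF c(2)] by simp
qed

section \<open>Operators on the Hilbert space\<close>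

lemma bounded_linear_matrix_mult: "bounded_linear (\<lambda>A :: cmat2. (m :: cmat2) ** A)"
  unfolding linear_conv_bounded_linear[symmetric]
  by (auto intro!: linearI simp: matrix_add_ldistrib)
    (simp add: matrix_matrix_mult_def vec_eq_iff scaleR_sum_right)

lemma bounded_bilinear_smult_mat: "bounded_bilinear (*\<^sub>M)"
  unfolding bilinear_conv_bounded_bilinear[symmetric] bilinear_def
  by (auto intro!: linearI simp: smult_mat_def vec_eq_iff algebra_simps)

lemma matrix_mult_smult_mat: "A ** (c *\<^sub>M B) = c *\<^sub>M (A ** B)" "(c *\<^sub>M A) ** B = c *\<^sub>M (A ** B)"
  by (simp_all add: smult_mat_def matrix_matrix_mult_def vec_eq_iff sum_distrib_left mult_ac)

text \<open>Identifies the real Euclidean product of matrices with the real part of the trace form;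
  the proof works with this real inner product throughout.\<close>

lemma inner_cmat2: "A \<bullet> B = Re (trace (ctranspose A ** B))"
  unfolding trace_ctranspose by (simp add: inner_vec_def inner_complex_def) (rule sum.swap)

lemma ctranspose_matrix_mult: "ctranspose (A ** B) = ctranspose B ** ctranspose A"
  by (simp add: ctranspose_def matrix_matrix_mult_def vec_eq_iff mult.commute)

lemma inner_matrix_mult: "(m ** A) \<bullet> B = A \<bullet> (ctranspose m ** B)" for m A B :: cmat2
  by (simp add: inner_cmat2 ctranspose_matrix_mult matrix_mul_assoc)

lemma L2_fun_smooth:
  assumes "F \<in> smooth_torus"
  shows "L2_fun F"
  unfolding L2_fun_def
proof (intro conjI)
  note c = smooth_torus_continuous[OF assms]
  show "F \<in> borel_measurable borel" using c by (rule borel_measurable_continuous_onI)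
  show "periodic F" using assms by (simp add: smooth_torus_def)
  show "integrable torus (\<lambda>p. (norm (F p))\<^sup>2)"
    by (intro continuous_integrable_torus continuous_intros c)
qed

lemma integrable_inner_torus:
  "L2_fun F \<Longrightarrow> L2_fun G \<Longrightarrow> integrable torus (\<lambda>p. F p \<bullet> G p)"
  unfolding inner_cmat2 by (intro integrable_Re integrable_trace_ctranspose)

lemma inner_abs_l2mat:
  assumes "L2_fun F" "L2_fun G"
  shows "inner (abs_l2mat F) (abs_l2mat G) = 1/2 * (LINT p|torus. F p \<bullet> G p)"
  using assms by (simp add: inner_l2mat_def cinner.abs_eq L2_rel_def inner_cmat2
      integral_Re integrable_trace_ctranspose)

lemma abs_l2mat_eq_zero_iff:
  assumes "L2_fun F"
  shows "abs_l2mat F = 0 \<longleftrightarrow> (AE p in torus. F p = 0)"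
  unfolding zero_l2mat.abs_eq using Quotient3_rel[OF Quotient3_l2mat, of F "\<lambda>p. 0"] assms
  by (simp add: L2_rel_def L2_fun_zero)

text \<open>Testing against \<open>\<phi> p *\<^sub>R E\<close> for constant \<open>E\<close> makes
  the scalar function \<open>V p \<bullet> E\<close> orthogonal to every smooth \<phi>. Finitely
  many basis matrices \<open>E\<close> then determine \<open>V p\<close> almost everywhere.\<close>

lemma smooth_dense:
  assumes "\<And>Q. Q \<in> smooth_torus \<Longrightarrow> inner v (abs_l2mat Q) = 0"
  shows "v = 0"
proof -
  obtain V where V: "L2_fun V" "v = abs_l2mat V" by (metis l2mat_cases)
  have "AE p in torus. V p \<bullet> E = 0" for E
  proof (rule AE_zero_if_orthogonal_smooth)
    show "integrable torus (\<lambda>p. V p \<bullet> E)"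
      by (intro integrable_inner_torus V L2_fun_smooth smooth_torus_const)
    fix \<phi> :: "real \<times> real \<Rightarrow> real"
    assume "\<phi> \<in> smooth_torus"
    then have "(\<lambda>p. \<phi> p *\<^sub>R E) \<in> smooth_torus"
      by (rule smooth_torus_linear[OF bounded_linear_scaleR_left])
    with assms[OF this] show "(LINT p|torus. \<phi> p * (V p \<bullet> E)) = 0"
      using V by (simp add: inner_abs_l2mat L2_fun_smooth)
  qed
  then have "AE p in torus. \<forall>E\<in>Basis. V p \<bullet> E = 0"
    by (intro AE_finite_allI) auto
  then have "AE p in torus. V p = 0"
    by eventually_elim (simp add: euclidean_all_zero_iff)
  then show ?thesis using V by (simp add: abs_l2mat_eq_zero_iff)
qed

section \<open>Left multiplication by constant matrices\<close>

lemma L2_fun_matrix_mult: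
  assumes "L2_fun F"
  shows "L2_fun (\<lambda>p. m ** F p)"
proof -
  obtain K where K: "\<And>A :: cmat2. norm (m ** A) \<le> norm A * K"
    using bounded_linear.bounded[OF bounded_linear_matrix_mult] by blast
  have m: "(\<lambda>p. m ** F p) \<in> borel_measurable borel"
    using assms unfolding L2_fun_def
    by (intro borel_measurable_continuous_on[OF linear_continuous_on[OF bounded_linear_matrix_mult]]) auto
  have "integrable torus (\<lambda>p. (norm (m ** F p))\<^sup>2)"
  proof (rule Bochner_Integration.integrable_bound)
    show "integrable torus (\<lambda>p. K\<^sup>2 * (norm (F p))\<^sup>2)"
      using assms by (auto simp: L2_fun_def)
    show "(\<lambda>p. (norm (m ** F p))\<^sup>2) \<in> borel_measurable torus"
      by (rule measurable_torus) (use m in measurable)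
    show "AE p in torus. norm ((norm (m ** F p))\<^sup>2) \<le> norm (K\<^sup>2 * (norm (F p))\<^sup>2)"
    proof (intro AE_I2)
      fix p
      have "(norm (m ** F p))\<^sup>2 \<le> (norm (F p) * K)\<^sup>2"
        by (intro power_mono K) simp
      then show "norm ((norm (m ** F p))\<^sup>2) \<le> norm (K\<^sup>2 * (norm (F p))\<^sup>2)"
        by (simp add: power_mult_distrib mult.commute)
    qed
  qed
  with m assms show ?thesis by (auto simp: L2_fun_def periodic_def)
qed

lift_definition left_mult :: "cmat2 \<Rightarrow> l2mat \<Rightarrow> l2mat" is "\<lambda>m F p. m ** F p"
  by (auto simp: L2_rel_def L2_fun_matrix_mult)

lemma left_mult_abs: "L2_fun F \<Longrightarrow> left_mult m (abs_l2mat F) = abs_l2mat (\<lambda>p. m ** F p)"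
  by (simp add: left_mult.abs_eq L2_rel_def)

lemma left_mult_in_bounded_ops: "left_mult m \<in> bounded_ops"
proof -
  obtain K where K: "K \<ge> 0" "\<And>A :: cmat2. norm (m ** A) \<le> norm A * K"
    using bounded_linear.nonneg_bounded[OF bounded_linear_matrix_mult] by blast
  have "left_mult m (v + w) = left_mult m v + left_mult m w" for v w
    by transfer (simp add: L2_rel_def L2_fun_add L2_fun_matrix_mult matrix_add_ldistrib)
  moreover have "left_mult m (c *\<^sub>C v) = c *\<^sub>C left_mult m v" for c v
    by transfer (simp add: L2_rel_def L2_fun_smult L2_fun_matrix_mult matrix_mult_smult_mat)
  moreover have "left_mult m (r *\<^sub>R v) = r *\<^sub>R left_mult m v" for r v
    by transfer (simp add: L2_rel_def L2_fun_scaleR L2_fun_matrix_mult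
        linear_cmul[OF bounded_linear.linear[OF bounded_linear_matrix_mult]])
  moreover have "norm (left_mult m v) \<le> norm v * K" for v
  proof -
    obtain F where F: "L2_fun F" "v = abs_l2mat F" by (metis l2mat_cases)
    have "(LINT p|torus. (norm (m ** F p))\<^sup>2) \<le> (LINT p|torus. K\<^sup>2 * (norm (F p))\<^sup>2)"
    proof (rule integral_mono)
      show "integrable torus (\<lambda>p. (norm (m ** F p))\<^sup>2)"
        using L2_fun_matrix_mult[OF F(1)] by (simp add: L2_fun_def)
      show "integrable torus (\<lambda>p. K\<^sup>2 * (norm (F p))\<^sup>2)"
        using F(1) by (simp add: L2_fun_def)
      show "(norm (m ** F p))\<^sup>2 \<le> K\<^sup>2 * (norm (F p))\<^sup>2" for p
        using power_mono[OF K(2) norm_ge_zero, of "F p" 2] by (simp add: power_mult_distrib mult.commute)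
    qed
    then have "norm (left_mult m v) \<le> sqrt (K\<^sup>2 * (1/2 * (LINT p|torus. (norm (F p))\<^sup>2)))"
      using F by (simp add: left_mult_abs norm_abs_l2mat L2_fun_matrix_mult del: real_sqrt_mult)
    also have "\<dots> = norm v * K"
      unfolding real_sqrt_mult[of "K\<^sup>2"] F(2) norm_abs_l2mat[OF F(1)] using K(1) by simp
    finally show ?thesis .
  qed
  ultimately show ?thesis
    unfolding bounded_ops_def by (auto intro!: bounded_linear_intro)
qed

lemma cinner_left_mult: "cinner (left_mult m v) w = cinner v (left_mult (ctranspose m) w)"
  by transfer (simp add: ctranspose_matrix_mult matrix_mul_assoc)

lemma inner_left_mult: "inner (left_mult m v) w = inner v (left_mult (ctranspose m) w)"
  by (simp add: inner_l2mat_def cinner_left_mult)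

lemma adj_left_mult: "adj (left_mult m) = left_mult (ctranspose m)"
  unfolding adj_def
proof (rule the_equality)
  fix S assume S: "\<forall>v w. cinner (left_mult m v) w = cinner v (S w)"
  have "inner v (S w) = inner v (left_mult (ctranspose m) w)" for v w
    using S by (simp add: inner_l2mat_def cinner_left_mult)
  then show "S = left_mult (ctranspose m)" by (metis ext vector_eq_ldot)
qed (simp add: cinner_left_mult)

lemma left_mult_mult_op_commute:
  assumes "f \<in> algA"
  shows "left_mult m (mult_op f v) = mult_op f (left_mult m v)"
proof -
  obtain F where F: "L2_fun F" "v = abs_l2mat F" by (metis l2mat_cases)
  then show ?thesis
    using assms by (simp add: left_mult_abs mult_op_abs L2_fun_mult L2_fun_matrix_mult matrix_mult_smult_mat)
qed

lemma mult_op_mult_op: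
  assumes "f \<in> algA" "g \<in> algA"
  shows "mult_op f (mult_op g v) = mult_op (\<lambda>p. f p * g p) v"
proof -
  obtain F where F: "L2_fun F" "v = abs_l2mat F" by (metis l2mat_cases)
  have "(\<lambda>p. f p * g p) \<in> algA"
    using assms by (rule smooth_torus_bilinear[OF bounded_bilinear_mult])
  then show ?thesis
    using assms F by (simp add: mult_op_abs L2_fun_mult) (simp add: smult_mat_def mult.assoc)
qed

lemma mult_op_one [simp]: "mult_op (\<lambda>p. 1) v = v"
proof -
  obtain F where F: "L2_fun F" "v = abs_l2mat F" by (metis l2mat_cases)
  moreover have "1 *\<^sub>M A = A" for A by (simp add: smult_mat_def)
  ultimately show ?thesis
    by (simp add: mult_op_abs smooth_torus_const)
qed

section \<open>The Dirac operator\<close>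

definition gamma1 :: cmat2 where "gamma1 = \<i> *\<^sub>M sigma1"
definition gamma2 :: cmat2 where "gamma2 = \<i> *\<^sub>M sigma2"

lemma D0_eq: "D0 F = (\<lambda>p. gamma1 ** pdx F p + gamma2 ** pdy F p)"
  by (auto simp: D0_def gamma1_def gamma2_def matrix_mult_smult_mat)

lemma ctranspose_gamma: "ctranspose gamma1 = - gamma1" "ctranspose gamma2 = - gamma2"
  by (simp_all add: gamma1_def gamma2_def ctranspose_def smult_mat_def sigma1_def sigma2_def
      vec_eq_iff forall_2)

lemma D0_smooth: "F \<in> smooth_torus \<Longrightarrow> D0 F \<in> smooth_torus"
  unfolding D0_eq
  by (intro smooth_torus_add smooth_torus_linear[OF bounded_linear_matrix_mult] smooth_torus_pd)

text \<open>Since the gammas are skew-hermitian, the difference of the two integrands is minus the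
  divergence of \<open>(f, g)\<close>, which integrates to zero over the torus.\<close>

lemma D0_symmetric:
  assumes F: "F \<in> smooth_torus" and G: "G \<in> smooth_torus"
  shows "inner (abs_l2mat (D0 F)) (abs_l2mat G) = inner (abs_l2mat F) (abs_l2mat (D0 G))"
proof -
  note lin = bounded_linear_matrix_mult
  define f g where "f = (\<lambda>p. F p \<bullet> (gamma1 ** G p))" and "g = (\<lambda>p. F p \<bullet> (gamma2 ** G p))"
  have sm: "f \<in> smooth_torus" "g \<in> smooth_torus"
    unfolding f_def g_def
    by (intro smooth_torus_bilinear[OF bounded_bilinear_inner] F smooth_torus_linear[OF lin] G)+
  have pd: "pdx f = (\<lambda>p. F p \<bullet> (gamma1 ** pdx G p) + pdx F p \<bullet> (gamma1 ** G p))"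
    "pdy g = (\<lambda>p. F p \<bullet> (gamma2 ** pdy G p) + pdy F p \<bullet> (gamma2 ** G p))"
    unfolding f_def g_def
    by (simp_all add: pd_bilinear[OF bounded_bilinear_inner F smooth_torus_linear[OF lin G]] pd_linear[OF lin G])
  have neg: "(- A) ** B = - (A ** B)" for A B :: cmat2
    by (simp add: matrix_matrix_mult_def vec_eq_iff sum_negf)
  have "D0 F p \<bullet> G p - F p \<bullet> D0 G p = - pdx f p - pdy g p" for p
    by (simp add: D0_eq pd inner_add_left inner_add_right inner_matrix_mult ctranspose_gamma neg)
  then have "(LINT p|torus. D0 F p \<bullet> G p - F p \<bullet> D0 G p) = (LINT p|torus. - pdx f p - pdy g p)"
    by simp
  also have "\<dots> = 0"
    using integral_torus_pd[OF sm(1)] integral_torus_pd[OF sm(2)]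
    by (simp add: continuous_integrable_torus smooth_torus_continuous smooth_torus_pd sm)
  finally show ?thesis
    using F G by (simp add: inner_abs_l2mat L2_fun_smooth D0_smooth integrable_inner_torus)
qed

lemma smooth_in_D_graph: "F \<in> smooth_torus \<Longrightarrow> (abs_l2mat F, abs_l2mat (D0 F)) \<in> D_graph"
  unfolding D_graph_def by (rule subsetD[OF closure_subset]) blast

lemma D_graph_induct:
  assumes "x \<in> D_graph" "closed {x. P x}"
    and "\<And>F. F \<in> smooth_torus \<Longrightarrow> P (abs_l2mat F, abs_l2mat (D0 F))"
  shows "P x"
proof -
  have "(\<lambda>F. (abs_l2mat F, abs_l2mat (D0 F))) ` smooth_torus \<subseteq> {x. P x}"
    using assms(3) by blast
  from closure_minimal[OF this assms(2)] show ?thesis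
    using assms(1) by (auto simp: D_graph_def)
qed

text \<open>Both sides are continuous in each pair, so symmetry passes to the closure in one
  argument at a time.\<close>

lemma D_graph_symmetric:
  assumes "(v, w) \<in> D_graph" "(v', w') \<in> D_graph"
  shows "inner w v' = inner v w'"
proof -
  have *: "inner (snd x) (abs_l2mat G) = inner (fst x) (abs_l2mat (D0 G))"
    if "G \<in> smooth_torus" "x \<in> D_graph" for x G
    using that(2)
  proof (rule D_graph_induct)
    show "closed {x. inner (snd x) (abs_l2mat G) = inner (fst x) (abs_l2mat (D0 G))}"
      by (intro closed_Collect_eq continuous_intros)
  qed (simp add: D0_symmetric that(1))
  have "inner w (fst y) = inner v (snd y)" if "y \<in> D_graph" for y
    using that
  proof (rule D_graph_induct)
    show "closed {y. inner w (fst y) = inner v (snd y)}"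
      by (intro closed_Collect_eq continuous_intros)
  qed (use *[OF _ assms(1)] in simp)
  from this[OF assms(2)] show ?thesis by simp
qed

text \<open>A symmetric operator with dense domain is closable: by symmetry two values at
  \<open>v\<close> have the same inner products with all smooth functions. This justifies the
  definite description in \<open>D_op\<close>.\<close>

lemma D_graph_unique:
  assumes "(v, w) \<in> D_graph" "(v, w') \<in> D_graph"
  shows "w = w'"
proof -
  have "inner (w - w') (abs_l2mat Q) = 0" if "Q \<in> smooth_torus" for Q
    using D_graph_symmetric[OF assms(1) smooth_in_D_graph[OF that]]
      D_graph_symmetric[OF assms(2) smooth_in_D_graph[OF that]]
    by (simp add: inner_diff_left)
  from smooth_dense[OF this] show ?thesis by simp
qed

lemma D_op_eq: "(v, w) \<in> D_graph \<Longrightarrow> D_op v = w"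
  unfolding D_op_def using D_graph_unique by blast

lemma in_D_graph_iff: "(v, w) \<in> D_graph \<longleftrightarrow> v \<in> D_dom \<and> w = D_op v"
  unfolding D_dom_def using D_op_eq by blast

lemma D_op_smooth:
  assumes "F \<in> smooth_torus"
  shows "abs_l2mat F \<in> D_dom" "D_op (abs_l2mat F) = abs_l2mat (D0 F)"
  using smooth_in_D_graph[OF assms] by (auto simp: in_D_graph_iff)

lemma D_op_symmetric: "v \<in> D_dom \<Longrightarrow> w \<in> D_dom \<Longrightarrow> inner (D_op v) w = inner v (D_op w)"
  using D_graph_symmetric[of v "D_op v" w "D_op w"] by (simp add: in_D_graph_iff)

lemma bounded_linear_mult_op: "b \<in> algA \<Longrightarrow> bounded_linear (mult_op b)"
  using mult_op_in_bounded_ops by (simp add: bounded_ops_def)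

lemma bounded_linear_left_mult: "bounded_linear (left_mult m)"
  using left_mult_in_bounded_ops by (simp add: bounded_ops_def)

section \<open>Commutators with Fourier modes and the Clifford elements they yield\<close>

text \<open>By the Leibniz rule the commutator of a first-order operator with a function is
  multiplication by the symbol at the gradient; for a mode the gradient is a constant vector times
  the mode itself.\<close>

lemma commutator_ext_mode:
  defines "\<xi> \<equiv> \<lambda>m n :: int. (2 * pi * m * \<i>) *\<^sub>M gamma1 + (2 * pi * n * \<i>) *\<^sub>M gamma2"
  shows "commutator_ext (mode m n) (left_mult (\<xi> m n) \<circ> mult_op (mode m n))"
proof -
  define b where "b = mode m n"
  define T where "T = left_mult (\<xi> m n) \<circ> mult_op b"
  have bs: "b \<in> algA" unfolding b_def by (rule mode_smooth)
  have T: "T \<in> bounded_ops"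
    using mult_op_in_bounded_ops[OF bs] left_mult_in_bounded_ops[of "\<xi> m n"]
    unfolding bounded_ops_def T_def o_def by (auto intro: bounded_linear_compose)
  then have T_lin: "bounded_linear T" by (simp add: bounded_ops_def)
  have smooth: "(mult_op b (abs_l2mat F), mult_op b (abs_l2mat (D0 F)) + T (abs_l2mat F)) \<in> D_graph"
    if F: "F \<in> smooth_torus" for F
  proof -
    note bF = smooth_torus_bilinear[OF bounded_bilinear_smult_mat bs F]
    note pd = pd_bilinear[OF bounded_bilinear_smult_mat bs F]
    have "D0 (\<lambda>p. b p *\<^sub>M F p) p = b p *\<^sub>M D0 F p + \<xi> m n ** (b p *\<^sub>M F p)" for p
      unfolding D0_eq pd unfolding b_def pd_mode \<xi>_def
      by (simp add: matrix_matrix_mult_def smult_mat_def vec_eq_iff sum_2 algebra_simps)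
    then have "D0 (\<lambda>p. b p *\<^sub>M F p) = (\<lambda>p. b p *\<^sub>M D0 F p + \<xi> m n ** (b p *\<^sub>M F p))" ..
    moreover have "mult_op b (abs_l2mat (D0 F)) + T (abs_l2mat F)
        = abs_l2mat (\<lambda>p. b p *\<^sub>M D0 F p + \<xi> m n ** (b p *\<^sub>M F p))"
      using F bs unfolding T_def
      by (simp add: mult_op_abs left_mult_abs plus_l2mat.abs_eq L2_rel_def L2_fun_smooth D0_smooth
          L2_fun_mult L2_fun_matrix_mult)
    ultimately show ?thesis
      using smooth_in_D_graph[OF bF] F bs by (simp add: mult_op_abs L2_fun_smooth)
  qed
  \<comment> \<open>The map from (v, w) to (b v, b w + T v) is continuous and sends the graph of
    \<open>D0\<close> into the closed \<open>D_graph\<close>, hence also the closure. This gives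
    invariance of the domain and the commutator formula at once.\<close>
  have "(mult_op b (fst x), mult_op b (snd x) + T (fst x)) \<in> D_graph" if "x \<in> D_graph" for x
    using that
  proof (rule D_graph_induct)
    have "continuous_on UNIV (\<lambda>x. (mult_op b (fst x), mult_op b (snd x) + T (fst x)))"
      by (intro continuous_intros bounded_linear.continuous_on[OF bounded_linear_mult_op[OF bs]]
          bounded_linear.continuous_on[OF T_lin])
    moreover have "closed D_graph" by (simp add: D_graph_def)
    ultimately have "closed ((\<lambda>x. (mult_op b (fst x), mult_op b (snd x) + T (fst x))) -` D_graph)"
      by (rule closed_vimage[rotated])
    then show "closed {x. (mult_op b (fst x), mult_op b (snd x) + T (fst x)) \<in> D_graph}"
      by (simp add: vimage_def)
  qed (use smooth in simp)
  then have "mult_op b v \<in> D_dom \<and> mult_op b (D_op v) + T v = D_op (mult_op b v)"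
    if "v \<in> D_dom" for v
    using that by (force simp: in_D_graph_iff)
  then have "mult_op b v \<in> D_dom \<and> T v = D_op (mult_op b v) - mult_op b (D_op v)"
    if "v \<in> D_dom" for v
    using that by (metis add_diff_cancel_left')
  then show ?thesis
    using T by (simp add: commutator_ext_def T_def b_def)
qed

text \<open>The principal symbols \<open>a[D, b]\<close> for \<open>b\<close> a coordinate Fourier mode and \<open>a\<close> its inverse;
  they are the hermitian matrices \<open>-2 \<pi> \<sigma>\<^sub>1\<close> and \<open>-2 \<pi> \<sigma>\<^sub>2\<close>.\<close>

definition xi1 :: cmat2 where "xi1 = (2 * pi * \<i>) *\<^sub>M gamma1"
definition xi2 :: cmat2 where "xi2 = (2 * pi * \<i>) *\<^sub>M gamma2"

lemma ctranspose_xi: "ctranspose xi1 = xi1" "ctranspose xi2 = xi2"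
  by (simp_all add: xi1_def xi2_def gamma1_def gamma2_def ctranspose_def smult_mat_def
      sigma1_def sigma2_def vec_eq_iff forall_2)

lemma commutator_ext_coordinate_modes:
  "commutator_ext (mode 1 0) (left_mult xi1 \<circ> mult_op (mode 1 0))"
  "commutator_ext (mode 0 1) (left_mult xi2 \<circ> mult_op (mode 0 1))"
proof -
  have "A + 0 *\<^sub>M B = A" "0 *\<^sub>M B + A = A" for A B by (simp_all add: smult_mat_def vec_eq_iff)
  then show "commutator_ext (mode 1 0) (left_mult xi1 \<circ> mult_op (mode 1 0))"
    "commutator_ext (mode 0 1) (left_mult xi2 \<circ> mult_op (mode 0 1))"
    using commutator_ext_mode[of 1 0] commutator_ext_mode[of 0 1] by (simp_all add: xi1_def xi2_def)
qed

lemma mult_op_mode_inverse: "mult_op (mode (-m) (-n)) (mult_op (mode m n) v) = v"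
  by (simp add: mult_op_mult_op mode_smooth mode_mult)

lemma left_mult_xi_in_Cl_D: "left_mult xi1 \<in> Cl_D" "left_mult xi2 \<in> Cl_D"
proof -
  have *: "left_mult m \<in> Cl_D"
    if "commutator_ext (mode j k) (left_mult m \<circ> mult_op (mode j k))" for m j k
  proof -
    \<comment> \<open>Left multiplication commutes with functions, so the inverse mode cancels the
      mode and leaves the bare matrix as a one-form.\<close>
    have "left_mult m = mult_op (mode (-j) (-k)) \<circ> (left_mult m \<circ> mult_op (mode j k))"
      by (simp add: fun_eq_iff left_mult_mult_op_commute[symmetric] mode_smooth mult_op_mode_inverse)
    then have "left_mult m \<in> one_forms"
      unfolding one_forms_def using that mode_smooth by (intro hull_inc) blast
    then show ?thesis unfolding Cl_D_def by (intro hull_inc) blast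
  qed
  show "left_mult xi1 \<in> Cl_D" "left_mult xi2 \<in> Cl_D"
    using commutator_ext_coordinate_modes by (auto intro: *)
qed

lemma mult_op_in_Cl_D: "f \<in> algA \<Longrightarrow> mult_op f \<in> Cl_D"
  unfolding Cl_D_def by (intro hull_inc) blast

text \<open>\<open>xi1\<close> is -2 \<pi> \<sigma>1, whose square is the nonzero scalar 4
  \<pi>^2.\<close>

lemma left_mult_xi1_eq_zero:
  assumes "left_mult xi1 v = 0"
  shows "v = 0"
proof -
  obtain F where F: "L2_fun F" "v = abs_l2mat F" by (metis l2mat_cases)
  have "xi1 ** (xi1 ** A) = (4 * pi\<^sup>2) *\<^sub>R A" for A :: cmat2
    by (simp add: vec_eq_iff forall_2 matrix_matrix_mult_def sum_2 xi1_def gamma1_def sigma1_def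
        smult_mat_def power2_eq_square scaleR_conv_of_real[where 'a=complex])
  then have "left_mult xi1 (left_mult xi1 v) = (4 * pi\<^sup>2) *\<^sub>R v"
    using F by (simp add: left_mult_abs L2_fun_matrix_mult scaleR_l2mat.abs_eq L2_rel_def)
  then show ?thesis
    using assms linear_0[OF bounded_linear.linear[OF bounded_linear_left_mult]] by simp
qed

text \<open>The commutators with the symbols recover \<open>D\<close> because \<open>\<gamma>\<^sub>1\<close> and \<open>\<gamma>\<^sub>2\<close> anticommute.\<close>

lemma D0_from_commutators:
  assumes F: "F \<in> smooth_torus"
  shows "(xi1 ** D0 (\<lambda>p. xi1 ** F p) p - D0 (\<lambda>p. xi1 ** (xi1 ** F p)) p)
    + (xi2 ** D0 (\<lambda>p. xi2 ** F p) p - D0 (\<lambda>p. xi2 ** (xi2 ** F p)) p) = (- 8 * pi\<^sup>2) *\<^sub>R D0 F p"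
proof -
  note lin = bounded_linear_matrix_mult
  note pd = pd_linear[OF lin smooth_torus_linear[OF lin F]] pd_linear[OF lin F]
  \<comment> \<open>Each xi squares to 4 \<pi>^2, commutes with its own gamma and anticommutes with
    the other. So the \<open>xi1\<close> part leaves -8 \<pi>^2 times the \<open>gamma2\<close>
    term, and the \<open>xi2\<close> part does the same for \<open>gamma1\<close>.\<close>
  have "(xi1 ** (gamma1 ** (xi1 ** A) + gamma2 ** (xi1 ** B))
        - (gamma1 ** (xi1 ** (xi1 ** A)) + gamma2 ** (xi1 ** (xi1 ** B))))
      + (xi2 ** (gamma1 ** (xi2 ** A) + gamma2 ** (xi2 ** B))
        - (gamma1 ** (xi2 ** (xi2 ** A)) + gamma2 ** (xi2 ** (xi2 ** B))))
      = (- 8 * pi\<^sup>2) *\<^sub>R (gamma1 ** A + gamma2 ** B)" for A B :: cmat2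
    by (simp add: vec_eq_iff forall_2 matrix_matrix_mult_def sum_2 xi1_def xi2_def gamma1_def
        gamma2_def sigma1_def sigma2_def smult_mat_def power2_eq_square
        scaleR_conv_of_real[where 'a=complex] algebra_simps)
  then show ?thesis unfolding D0_eq pd .
qed

section \<open>The antilinear isometry and the contradiction\<close>

text \<open>Real polarization expresses \<open>inner\<close> through norms of sums. An antilinear
  isometry conjugates \<open>cinner\<close> but preserves its real part, which is why the argument
  below uses \<open>inner\<close>.\<close>

lemma antilinear_isometry_inner:
  assumes "antilinear_isometry J"
  shows "inner (J v) (J w) = inner v w"
proof -
  have "J v + J w = J (v + w)" "norm (J u) = norm u" for u
    using assms by (auto simp: antilinear_isometry_def)
  then show ?thesis by (simp only: dot_norm)
qed

theorem theorem20:
  shows "\<not> (\<exists>J :: l2mat \<Rightarrow> l2mat.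
    bij J \<and> antilinear_isometry J \<and>
    J ` D_dom \<subseteq> D_dom \<and>
    (\<exists>\<epsilon>' \<in> {1, -1 :: real}. \<forall>v \<in> D_dom. J (D_op v) = \<epsilon>' *\<^sub>R D_op (J v)) \<and>
    opp J ` Cl_D \<subseteq> commutant Cl_D)"
proof
  assume "\<exists>J :: l2mat \<Rightarrow> l2mat.
    bij J \<and> antilinear_isometry J \<and>
    J ` D_dom \<subseteq> D_dom \<and>
    (\<exists>\<epsilon>' \<in> {1, -1 :: real}. \<forall>v \<in> D_dom. J (D_op v) = \<epsilon>' *\<^sub>R D_op (J v)) \<and>
    opp J ` Cl_D \<subseteq> commutant Cl_D"
  then obtain J \<epsilon> where "bij J" and iso: "antilinear_isometry J"
    and dom': "J ` D_dom \<subseteq> D_dom" and eps: "\<epsilon> \<in> {1, -1 :: real}"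
    and JD': "\<forall>v \<in> D_dom. J (D_op v) = \<epsilon> *\<^sub>R D_op (J v)"
    and opp: "opp J ` Cl_D \<subseteq> commutant Cl_D"
    by (elim exE conjE bexE)
  note dom = subsetD[OF dom' imageI] and JD = bspec[OF JD']
  define K where "K = inv J"
  have KJ [simp]: "K (J v) = v" "J (K v) = v" for v
    using \<open>bij J\<close> unfolding K_def by (simp_all add: bij_is_inj bij_is_surj surj_f_inv_f)
  have inner_K: "inner (K v) w = inner v (J w)" for v w
    using antilinear_isometry_inner[OF iso, of "K v" w] by simp
  have J0 [simp]: "J v = 0 \<longleftrightarrow> v = 0" for v
    using iso by (metis antilinear_isometry_def norm_eq_zero)

  define e where "e = mode 1 0"
  have e: "e \<in> algA" unfolding e_def by (rule mode_smooth)
  define T where "T v = left_mult xi1 (mult_op e v)" for v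
  have D_e: "mult_op e v \<in> D_dom" "T v = D_op (mult_op e v) - mult_op e (D_op v)" if "v \<in> D_dom" for v
    using commutator_ext_coordinate_modes(1) that
    by (auto simp: commutator_ext_def T_def e_def)

  define F where "F v = K (mult_op e (J v))" for v
  define H where "H v = K (T (J v))" for v

  \<comment> \<open>The domain condition is about \<open>J\<close>, not its inverse, so
    \<open>F v\<close> is kept out of \<open>D_op\<close>: after applying \<open>J\<close> to both
    sides, \<open>D\<close> is moved onto \<open>mult_op e (J v)\<close>, which does lie in the
    domain. Since \<open>D_op v = 0\<close>, what remains there is the commutator
    \<open>T\<close>.\<close>
  have F_H_D: "inner (F v) (D_op w) = \<epsilon> * inner (H v) w"
    if v: "v \<in> D_dom" "D_op v = 0" and w: "w \<in> D_dom" for v w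
  proof -
    have JD0: "D_op (J v) = 0" using JD[OF v(1)] v(2) eps J0[of 0] by auto
    have "inner (F v) (D_op w) = \<epsilon> * inner (mult_op e (J v)) (D_op (J w))"
      by (simp add: F_def inner_K JD[OF w])
    also have "\<dots> = \<epsilon> * inner (D_op (mult_op e (J v))) (J w)"
      using D_op_symmetric[OF D_e(1)[OF dom[OF v(1)]] dom[OF w]] by simp
    also have "D_op (mult_op e (J v)) = T (J v)"
      using D_e(2)[OF dom[OF v(1)]] JD0 linear_0[OF bounded_linear.linear[OF bounded_linear_mult_op[OF e]]]
      by simp
    finally show ?thesis by (simp add: H_def inner_K)
  qed

  \<comment> \<open>The second-order condition for self-adjoint \<xi>, whose opposite is
    \<open>J \<circ> \<xi> \<circ> K\<close>. Conjugating back by \<open>K\<close> makes \<xi>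
    commute with \<open>K \<circ> \<eta> \<circ> J\<close>, which is how \<open>F\<close> and
    \<open>H\<close> arise.\<close>
  have comm: "J (\<xi> (K (\<eta> v))) = \<eta> (J (\<xi> (K v)))"
    if "\<xi> \<in> Cl_D" "adj \<xi> = \<xi>" "\<eta> \<in> Cl_D" for \<xi> \<eta> v
  proof -
    have "opp J \<xi> \<circ> \<eta> = \<eta> \<circ> opp J \<xi>" using opp that unfolding commutant_def by blast
    then show ?thesis using that(2) by (simp add: opp_def K_def fun_eq_iff)
  qed
  have F_xi: "F (left_mult m v) = left_mult m (F v)" and H_xi: "H (left_mult m v) = left_mult m (H v)"
    if m: "m \<in> {xi1, xi2}" for m v
  proof -
    have X: "left_mult m \<in> Cl_D" "adj (left_mult m) = left_mult m"
      using m left_mult_xi_in_Cl_D by (auto simp: adj_left_mult ctranspose_xi)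
    note C = comm[OF X]
    have "mult_op e (J (left_mult m v)) = J (left_mult m (F v))"
      using C[OF mult_op_in_Cl_D[OF e], of "J v"] by (simp add: F_def)
    then show "F (left_mult m v) = left_mult m (F v)" by (simp add: F_def)
    have "T (J (left_mult m v)) = J (left_mult m (H v))"
      using C[OF left_mult_xi_in_Cl_D(1), of "mult_op e (J v)"]
        C[OF mult_op_in_Cl_D[OF e], of "J v"] by (simp add: T_def H_def)
    then show "H (left_mult m v) = left_mult m (H v)" by (simp add: H_def)
  qed

  \<comment> \<open>Constant matrices lie in the kernel of \<open>D\<close> and are mapped to
    constants by left multiplication, so \<open>F_H_D\<close> applies to \<open>p\<close> and to
    \<open>left_mult m p\<close> alike.\<close>
  define c where "c P = abs_l2mat (\<lambda>_. P)" for P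
  have c: "c P \<in> D_dom" "D_op (c P) = 0" "left_mult m (c P) = c (m ** P)" for P m
    using D_op_smooth[OF smooth_torus_const[of P]]
    by (simp_all add: c_def D0_eq pd_const left_mult_abs L2_fun_smooth smooth_torus_const zero_l2mat.abs_eq)
  define p where "p = c (mat 1)"
  \<comment> \<open>\<open>F p\<close> is orthogonal to the commutator of \<open>m\<close> with
    \<open>D\<close> on smooth functions: as \<open>m\<close> is hermitian and commutes with
    \<open>F\<close> and \<open>H\<close>, both terms equal \<epsilon> times the inner product of
    \<open>H (left_mult m p)\<close> with \<open>Q\<close>.\<close>
  have orth: "inner (F p) (abs_l2mat (\<lambda>x. m ** D0 Q x - D0 (\<lambda>x. m ** Q x) x)) = 0"
    if m: "m \<in> {xi1, xi2}" and Q: "Q \<in> smooth_torus" for m Q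
  proof -
    have mQ: "(\<lambda>x. m ** Q x) \<in> smooth_torus"
      by (rule smooth_torus_linear[OF bounded_linear_matrix_mult Q])
    have mh: "ctranspose m = m" using m ctranspose_xi by auto
    have "inner (F p) (left_mult m (D_op (abs_l2mat Q))) = inner (F (left_mult m p)) (D_op (abs_l2mat Q))"
      by (simp add: F_xi[OF m] inner_left_mult mh)
    also have "\<dots> = \<epsilon> * inner (H (left_mult m p)) (abs_l2mat Q)"
      unfolding p_def c(3) by (intro F_H_D c D_op_smooth Q)
    also have "\<dots> = \<epsilon> * inner (H p) (left_mult m (abs_l2mat Q))"
      by (simp add: H_xi[OF m] inner_left_mult mh)
    also have "\<dots> = inner (F p) (D_op (left_mult m (abs_l2mat Q)))"
      unfolding left_mult_abs[OF L2_fun_smooth[OF Q]] p_def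
      by (rule F_H_D[symmetric]) (intro c D_op_smooth mQ)+
    finally have "inner (F p) (left_mult m (D_op (abs_l2mat Q)) - D_op (left_mult m (abs_l2mat Q))) = 0"
      by (simp add: inner_diff_right)
    then show ?thesis
      using Q mQ by (simp add: D_op_smooth left_mult_abs L2_fun_smooth D0_smooth
          minus_l2mat.abs_eq L2_rel_def L2_fun_matrix_mult)
  qed

  have "inner (H p) (abs_l2mat Q) = 0" if Q: "Q \<in> smooth_torus" for Q
  proof -
    \<comment> \<open>\<open>orth\<close> is used with \<open>m ** Q\<close> in place of
      \<open>Q\<close>; summed over \<open>xi1\<close> and \<open>xi2\<close>, these commutators
      give a nonzero multiple of \<open>D0 Q\<close>. Hence \<open>F p\<close> is orthogonal to
      \<open>D0 Q\<close>, and \<open>F_H_D\<close> with \<epsilon> nonzero transfers this to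
      \<open>H p\<close>.\<close>
    define R where "R m x = m ** D0 (\<lambda>x. m ** Q x) x - D0 (\<lambda>x. m ** (m ** Q x)) x" for m x
    have mQ: "(\<lambda>x. m ** Q x) \<in> smooth_torus" "(\<lambda>x. m ** (m ** Q x)) \<in> smooth_torus" for m
      by (intro smooth_torus_linear[OF bounded_linear_matrix_mult] Q)+
    have L2: "L2_fun (R m)" for m
      unfolding R_def by (intro L2_fun_minus L2_fun_matrix_mult L2_fun_smooth D0_smooth mQ)
    have "0 = inner (F p) (abs_l2mat (R xi1) + abs_l2mat (R xi2))"
      using orth[OF _ mQ(1)] unfolding R_def by (simp add: inner_add_right)
    also have "abs_l2mat (R xi1) + abs_l2mat (R xi2) = abs_l2mat (\<lambda>x. (- 8 * pi\<^sup>2) *\<^sub>R D0 Q x)"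
      using L2 D0_from_commutators[OF Q] by (simp add: plus_l2mat.abs_eq L2_rel_def R_def)
    also have "\<dots> = (- 8 * pi\<^sup>2) *\<^sub>R D_op (abs_l2mat Q)"
      unfolding D_op_smooth(2)[OF Q]
      by (rule scaleR_l2mat.abs_eq[symmetric]) (simp add: Q L2_rel_def L2_fun_smooth D0_smooth)
    finally have "inner (F p) (D_op (abs_l2mat Q)) = 0" by simp
    then show ?thesis
      using F_H_D[of p "abs_l2mat Q"] eps c D_op_smooth[OF Q] by (auto simp: p_def)
  qed
  then have "H p = 0" by (rule smooth_dense)
  then have "T (J p) = 0" unfolding H_def by (metis KJ(2) J0)
  then have "mult_op e (J p) = 0" unfolding T_def by (rule left_mult_xi1_eq_zero)
  then have "J p = 0"
    using mult_op_mode_inverse[of 1 0 "J p"]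
      linear_0[OF bounded_linear.linear[OF bounded_linear_mult_op[OF mode_smooth]]]
    by (simp add: e_def)
  \<comment> \<open>Injectivity of \<open>J\<close> gives \<open>p = 0\<close> in the space of
    classes. A nonzero constant vanishing almost everywhere would make the unit square a null set,
    whereas its measure is 1.\<close>
  then have "AE x in torus. (mat 1 :: cmat2) = 0"
    unfolding J0 p_def c_def by (subst (asm) abs_l2mat_eq_zero_iff) (auto intro: L2_fun_smooth smooth_torus_const)
  moreover have "(mat 1 :: cmat2) \<noteq> 0" by (simp add: mat_def vec_eq_iff)
  ultimately have "AE x in torus. False" by simp
  then have "emeasure torus (space torus) = 0"
    unfolding ae_filter_eq_bot_iff[symmetric] trivial_limit_def .
  moreover have "emeasure torus (space torus) = emeasure lborel (cbox (0, 0) (1 :: real, 1 :: real))"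
    unfolding torus_def by (subst emeasure_restrict_space) (auto simp: space_restrict_space cbox_Pair_eq intro!: borel_closed closed_Times)
  ultimately show False
    by (simp add: emeasure_lborel_cbox_eq Basis_prod_def)
qed

end
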